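(* Let $n\ge 1$ and let $D\subset\mathbb{C}^n$ be a bounded, balanced, convex and homogeneous domain. Then $m_D(z)=1$ for all $z\in D$, where $m_D=s_D/e_D$ is the quotient of the squeezing function by the Fridman invariant of $D$.
   Context: A domain is a nonempty connected open set. A domain $D\subset\mathbb{C}^n$ is balanced if for every $z\in D$ one has $\lambda z\in D$ for all $\lambda\in\mathbb{C}$ with $|\lambda|\le 1$. $D$ is homogeneous if its group of biholomorphic automorphisms acts transitively on $D$. $\mathbb{B}^n$ is the open Euclidean unit ball in $\mathbb{C}^n$ centered at $0$, and $r\mathbb{B}^n$ is the ball of radius $r$. For domains $D_1,D_2\subset\mathbb{C}^n$, $\mathcal{O}_u(D_1,D_2)$ is the set of injective holomorphic maps $D_1\to D_2$. $k_D$ is the Kobayashi (pseudo)distance on $D$, normalized so that on the unit disk $\Delta\subset\mathbb{C}$ one has $k_\Delta(0,z)=\operatorname{artanh}|z|$: $k_D(z,w)$ is the infimum of $\sum_{j=1}^N k_\Delta(a_j,b_j)$ over all chains of holomorphic maps $f_j:\Delta\to D$ with $f_1(a_1)=z$, $f_j(b_j)=f_{j+1}(a_{j+1})$, $f_N(b_N)=w$. For $z\in D$, $r>0$, let $B_D^k(z,r)=\{w\in D: k_D(z,w)<r\}$. For a bounded domain $D\subset\mathbb{C}^n$ and $z\in D$, the Fridman invariant is $$e_D(z)=\sup\{\tanh(r): r>0,\ B_D^k(z,r)\subset f(\mathbb{B}^n) \text{ for some } f\in\mathcal{O}_u(\mathbb{B}^n,D) \text{ with } f(0)=z\},$$ the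 squeezing function is $$s_D(z)=\sup\{r>0: r\mathbb{B}^n\subset f(D) \text{ for some } f\in\mathcal{O}_u(D,\mathbb{B}^n) \text{ with } f(z)=0\},$$ both take values in $(0,1]$, and $m_D(z)=s_D(z)/e_D(z)$. *)

theory Defs
  imports "HOL-Analysis.Analysis"
begin

text \<open>
  Complex $n$-space is the type \<^typ>\<open>complex ^ 'n\<close>, whose library norm is the Euclidean norm and whose
  complex scalar multiplication is \<^term>\<open>(*s)\<close>.
\<close>

definition cdomain :: "(complex ^ 'n) set \<Rightarrow> bool" where
  "cdomain D \<longleftrightarrow> open D \<and> connected D \<and> D \<noteq> {}"

definition balanced :: "(complex ^ 'n) set \<Rightarrow> bool" where
  "balanced D \<longleftrightarrow> (\<forall>z\<in>D. \<forall>c::complex. norm c \<le> 1 \<longrightarrow> c *s z \<in> D)"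

text \<open>Holomorphy on an open set: the real Frechet derivative exists and is complex linear.\<close>

definition cholomorphic_on :: "(complex ^ 'n \<Rightarrow> complex ^ 'm) \<Rightarrow> (complex ^ 'n) set \<Rightarrow> bool" where
  "cholomorphic_on f D \<longleftrightarrow>
     (\<forall>z\<in>D. \<exists>L. Vector_Spaces.linear (*s) (*s) L \<and> (f has_derivative L) (at z))"

definition inj_hol :: "(complex ^ 'n) set \<Rightarrow> (complex ^ 'n) set \<Rightarrow> (complex ^ 'n \<Rightarrow> complex ^ 'n) set" where
  "inj_hol D1 D2 = {f. cholomorphic_on f D1 \<and> inj_on f D1 \<and> f ` D1 \<subseteq> D2}"

definition automorphism :: "(complex ^ 'n) set \<Rightarrow> (complex ^ 'n \<Rightarrow> complex ^ 'n) \<Rightarrow> bool" where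
  "automorphism D f \<longleftrightarrow>
     bij_betw f D D \<and> cholomorphic_on f D \<and> cholomorphic_on (inv_into D f) D"

definition homogeneous :: "(complex ^ 'n) set \<Rightarrow> bool" where
  "homogeneous D \<longleftrightarrow> (\<forall>z\<in>D. \<forall>w\<in>D. \<exists>f. automorphism D f \<and> f z = w)"

definition poincare_dist :: "complex \<Rightarrow> complex \<Rightarrow> real" where
  "poincare_dist a b = artanh (cmod ((a - b) / (1 - cnj a * b)))"

lemma poincare_dist_0: "poincare_dist 0 z = artanh (cmod z)"
  by (simp add: poincare_dist_def)

definition analytic_disc :: "(complex ^ 'n) set \<Rightarrow> (complex \<Rightarrow> complex ^ 'n) \<Rightarrow> bool" where
  "analytic_disc D f \<longleftrightarrow> (\<forall>i. (\<lambda>t. f t $ i) holomorphic_on ball 0 1) \<and> f ` ball 0 1 \<subseteq> D"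

definition disc_chain ::
  "(complex ^ 'n) set \<Rightarrow> complex ^ 'n \<Rightarrow> complex ^ 'n \<Rightarrow> nat \<Rightarrow>
     (nat \<Rightarrow> complex \<Rightarrow> complex ^ 'n) \<Rightarrow> (nat \<Rightarrow> complex) \<Rightarrow> (nat \<Rightarrow> complex) \<Rightarrow> bool" where
  "disc_chain D z w N f a b \<longleftrightarrow>
     N \<ge> 1 \<and>
     (\<forall>j\<in>{1..N}. analytic_disc D (f j) \<and> a j \<in> ball 0 1 \<and> b j \<in> ball 0 1) \<and>
     f 1 (a 1) = z \<and> (\<forall>j\<in>{1..<N}. f j (b j) = f (Suc j) (a (Suc j))) \<and> f N (b N) = w"

text \<open>
  The infimum is taken in the reals: all chain sums are nonnegative, and any two points of a
  domain are joined by a chain.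
\<close>

definition kobayashi :: "(complex ^ 'n) set \<Rightarrow> complex ^ 'n \<Rightarrow> complex ^ 'n \<Rightarrow> real" where
  "kobayashi D z w = Inf {\<Sum>j=1..N. poincare_dist (a j) (b j) | N f a b. disc_chain D z w N f a b}"

definition kobayashi_ball :: "(complex ^ 'n) set \<Rightarrow> complex ^ 'n \<Rightarrow> real \<Rightarrow> (complex ^ 'n) set" where
  "kobayashi_ball D z r = {w\<in>D. kobayashi D z w < r}"

text \<open>
  For a bounded domain and a point of it, the sets below are nonempty and bounded above by 1, so
  the suprema are genuine.
\<close>

definition fridman :: "(complex ^ 'n) set \<Rightarrow> complex ^ 'n \<Rightarrow> real" where
  "fridman D z =
     Sup {tanh r | r. r > 0 \<and> (\<exists>f\<in>inj_hol (ball 0 1) D. f 0 = z \<and> kobayashi_ball D z r \<subseteq> f ` ball 0 1)}"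

definition squeezing :: "(complex ^ 'n) set \<Rightarrow> complex ^ 'n \<Rightarrow> real" where
  "squeezing D z =
     Sup {r. r > 0 \<and> (\<exists>f\<in>inj_hol D (ball 0 1). f z = 0 \<and> ball 0 r \<subseteq> f ` D)}"

definition quotient_inv :: "(complex ^ 'n) set \<Rightarrow> complex ^ 'n \<Rightarrow> real" where
  "quotient_inv D z = squeezing D z / fridman D z"

end

theory Submission
  imports Defs "HOL-Complex_Analysis.Riemann_Mapping"
begin

text \<open>
  By homogeneity and biholomorphic invariance it suffices to treat \<open>z = 0\<close>. There the Kobayashi ball of
  radius \<open>artanh t\<close> is \<open>t D\<close>, and both invariants turn out to be the supremum of those \<open>t\<close> for which a
  linear isomorphism squeezes \<open>D\<close> between the balls of radii \<open>t\<close> and \<open>1\<close>. This follows by linearising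
  at \<open>0\<close>: if \<open>f\<close> is an injective holomorphic map between balanced convex domains fixing \<open>0\<close> with
  \<open>t G2 \<subseteq> f G1\<close>, then the Schwarz lemma for \<open>f\<close> and for its inverse, tested against linear functionals,
  gives \<open>L G1 \<subseteq> G2\<close> and \<open>t G2 \<subseteq> L G1\<close> for \<open>L = f' 0\<close>. That injective holomorphic maps are biholomorphic
  is not used: the inverse is continuous by invariance of domain, holomorphic off the zeros of the
  Jacobian determinant, and these zeros have empty interior by Sard's theorem, which is enough for
  a Schwarz lemma.
\<close>

subsection \<open>Complex linear maps, curves and functionals\<close>

text \<open>Bilinear, not Hermitian, so that every complex linear functional has the form \<open>cpair a\<close>.\<close>

definition cpair :: "complex ^ 'n \<Rightarrow> complex ^ 'n \<Rightarrow> complex" where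
  "cpair a z = (\<Sum>i\<in>UNIV. a $ i * z $ i)"

lemma cpair_smult [simp]: "cpair a (c *s z) = c * cpair a z"
  by (simp add: cpair_def sum_distrib_left algebra_simps)

lemma cpair_0 [simp]: "cpair a 0 = 0"
  by (simp add: cpair_def)

lemma scaleR_vec_eq_smult: "r *\<^sub>R (z :: complex ^ 'n) = complex_of_real r *s z"
  by (simp add: vec_eq_iff) (simp add: scaleR_conv_of_real)

lemma norm_smult: "norm (c *s z) = cmod c * norm (z :: complex ^ 'n)"
  by (simp add: norm_vec_def norm_mult L2_set_right_distrib)

lemma bounded_linear_smult_left: "bounded_linear (\<lambda>h. h *s (v :: complex ^ 'n))"
  by (intro linear_conv_bounded_linear[THEN iffD1] linearI)
     (auto simp: vec_eq_iff algebra_simps)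

lemma bounded_linear_cpair: "bounded_linear (cpair a)"
  by (intro linear_conv_bounded_linear[THEN iffD1] linearI)
     (auto simp: cpair_def algebra_simps sum.distrib scaleR_sum_right)

lemma bounded_linear_clinear:
  fixes L :: "complex ^ 'n \<Rightarrow> complex ^ 'm"
  assumes "Vector_Spaces.linear (*s) (*s) L"
  shows "bounded_linear L"
proof -
  interpret Vector_Spaces.linear "(*s)" "(*s)" L by fact
  show ?thesis
    by (intro linear_conv_bounded_linear[THEN iffD1] linearI)
       (auto simp: add scale scaleR_vec_eq_smult)
qed

lemma continuous_on_cpair [continuous_intros]:
  "continuous_on S f \<Longrightarrow> continuous_on S (\<lambda>x. cpair a (f x))"
  by (rule bounded_linear.continuous_on[OF bounded_linear_cpair])

lemma tendsto_cpair [tendsto_intros]: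
  "(f \<longlongrightarrow> l) F \<Longrightarrow> ((\<lambda>x. cpair a (f x)) \<longlongrightarrow> cpair a l) F"
  by (rule bounded_linear.tendsto[OF bounded_linear_cpair])

lemma inner_eq_Re_cpair: "a \<bullet> z = Re (cpair (\<chi> i. cnj (a $ i)) z)"
  by (simp add: cpair_def inner_vec_def inner_complex_def)

text \<open>A Frechet derivative of the form \<open>\<lambda>h. h *s v\<close> says that a curve of
  one complex variable is complex differentiable with velocity \<open>v\<close>. Working with such
  curves reduces every holomorphy question in several variables to one-variable function
  theory.\<close>

lemma cpair_has_field_derivative:
  assumes "(\<gamma> has_derivative (\<lambda>h. h *s v)) (at t)"
  shows "((\<lambda>t. cpair a (\<gamma> t)) has_field_derivative cpair a v) (at t)"
  using bounded_linear.has_derivative[OF bounded_linear_cpair[of a] assms]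
  by (simp add: has_field_derivative_def mult_commute_abs)

lemma curve_component_field_derivative:
  assumes "(\<gamma> has_derivative (\<lambda>h. h *s v)) (at t)"
  shows "((\<lambda>t. \<gamma> t $ i) has_field_derivative v $ i) (at t)"
  using bounded_linear.has_derivative[OF bounded_linear_vec_nth[of i] assms]
  by (simp add: has_field_derivative_def mult_commute_abs)

lemma has_derivative_vecI:
  fixes f :: "'a::real_normed_vector \<Rightarrow> 'b::euclidean_space ^ 'n"
  assumes "\<And>i. ((\<lambda>x. f x $ i) has_derivative (\<lambda>h. f' h $ i)) (at t within S)"
  shows "(f has_derivative f') (at t within S)"
  unfolding has_derivative_componentwise_within[of f]
proof
  fix b :: "'b ^ 'n" assume "b \<in> Basis"
  then obtain i u where b: "b = axis i u" "u \<in> Basis"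
    by (auto simp: Basis_vec_def)
  show "((\<lambda>x. f x \<bullet> b) has_derivative (\<lambda>x. f' x \<bullet> b)) (at t within S)"
    using assms[of i, unfolded has_derivative_componentwise_within[of "\<lambda>x. f x $ i"]] b
    by (simp add: inner_axis)
qed

lemma curve_has_derivativeI:
  fixes \<gamma> :: "complex \<Rightarrow> complex ^ 'n"
  assumes "\<And>i. ((\<lambda>t. \<gamma> t $ i) has_field_derivative v $ i) (at t)"
  shows "(\<gamma> has_derivative (\<lambda>h. h *s v)) (at t)"
  using assms by (intro has_derivative_vecI) (simp add: has_field_derivative_def mult_commute_abs)

lemma holomorphic_curve_has_derivative:
  assumes "\<And>i. (\<lambda>t. \<gamma> t $ i) holomorphic_on S" "open S" "t \<in> S"
  shows "\<exists>v. (\<gamma> has_derivative (\<lambda>h. h *s v)) (at t)"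
proof
  show "(\<gamma> has_derivative (\<lambda>h. h *s (\<chi> i. deriv (\<lambda>t. \<gamma> t $ i) t))) (at t)"
    using holomorphic_derivI[OF assms(1,2,3)] by (intro curve_has_derivativeI) simp
qed

lemma clinear_curve_has_derivative:
  assumes L: "Vector_Spaces.linear (*s) (*s) L" and f: "(f has_derivative L) (at (\<gamma> t))"
    and \<gamma>: "(\<gamma> has_derivative (\<lambda>h. h *s v)) (at t)"
  shows "((\<lambda>t. f (\<gamma> t)) has_derivative (\<lambda>h. h *s L v)) (at t)"
proof -
  interpret Vector_Spaces.linear "(*s)" "(*s)" L by fact
  show ?thesis
    using has_derivative_compose[OF \<gamma> f] by (simp add: scale)
qed

text \<open>Complex linearity of the derivative of \<open>f\<close> keeps the velocity form
  \<open>h *s v'\<close>, so holomorphic curves go to holomorphic curves.\<close>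

lemma cholomorphic_curve:
  assumes "cholomorphic_on f G" "\<gamma> t \<in> G" "(\<gamma> has_derivative (\<lambda>h. h *s v)) (at t)"
  shows "\<exists>v'. ((\<lambda>t. f (\<gamma> t)) has_derivative (\<lambda>h. h *s v')) (at t)"
  using assms clinear_curve_has_derivative unfolding cholomorphic_on_def by metis

lemma affine_curve_has_derivative:
  fixes c v :: "complex ^ 'n"
  shows "((\<lambda>t. c + t *s v) has_derivative (\<lambda>h. h *s v)) (at t)"
  using has_derivative_add[OF has_derivative_const[of c]
      bounded_linear_imp_has_derivative[OF bounded_linear_smult_left]] by simp

lemma cholomorphic_on_imp_continuous_on:
  assumes "cholomorphic_on f D" shows "continuous_on D f"
  using assms unfolding cholomorphic_on_def
  by (meson continuous_at_imp_continuous_on has_derivative_continuous)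

lemma cholomorphic_on_clinear:
  "Vector_Spaces.linear (*s) (*s) L \<Longrightarrow> cholomorphic_on L D"
  unfolding cholomorphic_on_def
  using bounded_linear_imp_has_derivative[OF bounded_linear_clinear[of L]] by blast

lemma cholomorphic_on_compose:
  assumes "cholomorphic_on f A" "cholomorphic_on g B" "f ` A \<subseteq> B"
  shows "cholomorphic_on (g \<circ> f) A"
  unfolding cholomorphic_on_def
proof
  fix z assume z: "z \<in> A"
  obtain L M where "Vector_Spaces.linear (*s) (*s) L" "(f has_derivative L) (at z)"
    "Vector_Spaces.linear (*s) (*s) M" "(g has_derivative M) (at (f z))"
    using assms z unfolding cholomorphic_on_def by blast
  then show "\<exists>L. Vector_Spaces.linear (*s) (*s) L \<and> (g \<circ> f has_derivative L) (at z)"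
    by (intro exI[of _ "M \<circ> L"] conjI diff_chain_at Vector_Spaces.linear_compose)
qed

text \<open>A real hyperplane separates \<open>p\<close> from \<open>G\<close>. Its real functional
  is the real part of a complex one, and since \<open>G\<close> is invariant under rotation by
  unimodular scalars, the bound on the real part becomes a bound on the modulus. Dividing by the
  level \<open>b\<close> normalises it to 1. This is what lets membership in \<open>G\<close> be
  tested by scalar Schwarz lemmas.\<close>

lemma balanced_convex_separation:
  fixes G :: "(complex ^ 'n) set"
  assumes G: "open G" "balanced G" "convex G" "G \<noteq> {}" and p: "p \<notin> G"
  obtains a where "\<And>z. z \<in> G \<Longrightarrow> cmod (cpair a z) < 1" "1 \<le> cmod (cpair a p)"
proof -
  obtain z0 where z0: "z0 \<in> G" using G by blast
  have 0: "0 \<in> G" using G(2) z0 unfolding balanced_def by (metis norm_zero vector_smult_lzero zero_le_one)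
  obtain a b where a: "a \<noteq> 0" "\<And>x. x \<in> G \<Longrightarrow> a \<bullet> x \<le> b" "b \<le> a \<bullet> p"
    using separating_hyperplane_sets[of G "{p}"] G p by auto
  have strict: "a \<bullet> x < b" if "x \<in> G" for x
  proof -
    obtain e where e: "e > 0" "cball x e \<subseteq> G" using G(1) \<open>x \<in> G\<close> open_contains_cball by blast
    \<comment> \<open>A step of length \<open>e\<close> in the direction \<open>a\<close> stays in
      \<open>G\<close> and strictly increases the functional, so no point of \<open>G\<close>
      attains the level \<open>b\<close>.\<close>
    have "x + (e / norm a) *\<^sub>R a \<in> cball x e" using e a(1) by (simp add: dist_norm)
    then have "a \<bullet> (x + (e / norm a) *\<^sub>R a) \<le> b" using e a by blast
    moreover have "e / norm a * (a \<bullet> a) > 0" using e a(1) by simp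
    ultimately show ?thesis by (simp add: inner_add_right)
  qed
  define c where "c = (\<chi> i. cnj (a $ i))"
  have b: "b > 0" using strict[OF 0] by simp
  have lt: "cmod (cpair c z) < b" if "z \<in> G" for z
  proof (cases "cpair c z = 0")
    case False
    \<comment> \<open>The unimodular factor that rotates \<open>cpair c z\<close> onto the positive
      real axis.\<close>
    define u where "u = cnj (sgn (cpair c z))"
    have "u *s z \<in> G" using G(2) that False unfolding balanced_def by (simp add: u_def norm_sgn)
    then have "Re (cpair c (u *s z)) < b" using strict inner_eq_Re_cpair c_def by metis
    moreover have "cpair c (u *s z) = of_real (cmod (cpair c z))"
    proof -
      have "cnj (sgn x) * x = of_real (cmod x)" for x :: complex
      proof -
        have "cnj (sgn x) * x = of_real (inverse (cmod x)) * (x * cnj x)"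
          by (simp add: sgn_div_norm scaleR_conv_of_real)
        also have "x * cnj x = of_real ((cmod x)\<^sup>2)"
          by (rule complex_norm_square[symmetric])
        finally show ?thesis by (cases "x = 0") (simp_all add: power2_eq_square)
      qed
      then show ?thesis by (simp add: u_def)
    qed
    ultimately show ?thesis by (metis Re_complex_of_real)
  qed (use b in simp)
  have ge: "b \<le> cmod (cpair c p)"
    using a(3) complex_Re_le_cmod[of "cpair c p"] inner_eq_Re_cpair[of a p] c_def by simp
  have eq: "cmod (cpair (of_real (1 / b) *s c) z) = cmod (cpair c z) / b" for z
  proof -
    have "cpair (of_real (1 / b) *s c) z = of_real (1 / b) * cpair c z"
      by (simp only: cpair_def sum_distrib_left vector_smult_component mult.assoc)
    then show ?thesis using b by (simp add: norm_mult norm_divide)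
  qed
  show ?thesis
    using lt ge b by (intro that[of "of_real (1 / b) *s c"]) (simp_all only: eq, simp_all)
qed

subsection \<open>Partial derivatives of holomorphic maps\<close>

text \<open>The product \<open>v ^ N * H\<close> vanishes at the zeros of \<open>H\<close>, so on
  the frontier of the set where \<open>H\<close> is nonzero only the unit circle matters and gives
  the bound \<open>M ^ N * K\<close>. If \<open>cmod (v z)\<close> exceeded \<open>M\<close>, the
  powers of their ratio would be unbounded in \<open>N\<close>, while \<open>K / cmod (H z)\<close>
  is fixed.\<close>

lemma maximum_modulus_off_zeros:
  fixes v H :: "complex \<Rightarrow> complex"
  assumes v: "continuous_on (cball 0 1) v" and H: "continuous_on (cball 0 1) H"
    and hol: "v holomorphic_on {z\<in>ball 0 1. H z \<noteq> 0}" "H holomorphic_on {z\<in>ball 0 1. H z \<noteq> 0}"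
    and M: "M > 0" "\<And>z. cmod z = 1 \<Longrightarrow> cmod (v z) \<le> M"
    and z: "z \<in> ball 0 1" "H z \<noteq> 0"
  shows "cmod (v z) \<le> M"
proof (rule ccontr)
  assume "\<not> cmod (v z) \<le> M"
  define \<Omega> where "\<Omega> = {z\<in>ball 0 1. H z \<noteq> 0}"
  obtain K where K: "\<And>x. x \<in> cball 0 1 \<Longrightarrow> cmod (H x) \<le> K"
    using compact_continuous_image[OF H compact_cball, THEN compact_imp_bounded]
    unfolding bounded_iff by (meson imageI)
  have op: "open \<Omega>"
  proof -
    have "continuous_on (ball 0 1) H" using H continuous_on_subset ball_subset_cball by blast
    then have "open (ball 0 1 \<inter> H -` (- {0}))"
      by (intro continuous_open_preimage) auto
    moreover have "ball 0 1 \<inter> H -` (- {0}) = \<Omega>" by (auto simp: \<Omega>_def)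
    ultimately show ?thesis by simp
  qed
  have sub: "closure \<Omega> \<subseteq> cball 0 1"
    by (rule closure_minimal) (auto simp: \<Omega>_def)
  have bound: "cmod (v z) ^ N * cmod (H z) \<le> M ^ N * K" for N
  proof -
    have "cmod (v z ^ N * H z) \<le> M ^ N * K"
    proof (rule maximum_modulus_frontier[of "\<lambda>z. v z ^ N * H z" \<Omega>])
      show "(\<lambda>z. v z ^ N * H z) holomorphic_on interior \<Omega>"
        using hol op unfolding \<Omega>_def[symmetric] by (auto simp: interior_open intro!: holomorphic_intros)
      show "continuous_on (closure \<Omega>) (\<lambda>z. v z ^ N * H z)"
        using v H sub by (intro continuous_intros) (auto intro: continuous_on_subset)
      show "bounded \<Omega>" unfolding \<Omega>_def by (rule bounded_subset[of "ball 0 1"]) auto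
      show "z \<in> \<Omega>" using z by (simp add: \<Omega>_def)
      fix w assume "w \<in> frontier \<Omega>"
      then have w: "w \<in> cball 0 1" "w \<notin> \<Omega>" using sub op by (auto simp: frontier_def interior_open)
      have K0: "0 \<le> K" using K[of 0] by (smt (verit) centre_in_cball norm_ge_zero)
      show "cmod (v w ^ N * H w) \<le> M ^ N * K"
      proof (cases "H w = 0")
        case True then show ?thesis using M(1) K0 by simp
      next
        case False
        then have "cmod w = 1" using w by (auto simp: \<Omega>_def)
        then show ?thesis using M w(1) K unfolding norm_mult norm_power
          by (intro mult_mono power_mono) auto
      qed
    qed
    then show ?thesis by (simp add: norm_mult norm_power)
  qed
  have "(cmod (v z) / M) ^ N \<le> K / cmod (H z)" for N
    using bound[of N] M z(2) by (simp add: field_simps)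
  moreover obtain N where "K / cmod (H z) < (cmod (v z) / M) ^ N"
    using real_arch_pow[of "cmod (v z) / M"] \<open>\<not> cmod (v z) \<le> M\<close> M(1) by auto
  ultimately show False by (meson not_le)
qed

text \<open>Discs of radius \<open>d/2\<close> about points of \<open>ball 0 (d/4)\<close> stay in
  \<open>ball 0 d\<close>, so the Cauchy estimate bounds the second derivative by
  \<open>2 * (M + 1) / (d/2)\<^sup>2\<close>. The constant depends only on \<open>M\<close> and
  \<open>d\<close>, which later makes the estimate uniform in a parameter.\<close>

lemma first_order_Taylor_bound:
  assumes hol: "\<phi> holomorphic_on ball 0 d" and d: "d > 0"
    and M: "\<And>t. t \<in> ball 0 d \<Longrightarrow> cmod (\<phi> t) \<le> M" and t: "cmod t < d / 4"
  shows "cmod (\<phi> t - \<phi> 0 - deriv \<phi> 0 * t) \<le> 8 * (M + 1) / d\<^sup>2 * (cmod t)\<^sup>2"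
proof -
  have D: "((deriv ^^ i) \<phi> has_field_derivative (deriv ^^ Suc i) \<phi> x) (at x within ball 0 (d/4))"
    if "x \<in> ball 0 (d/4)" for i x
  proof -
    have "x \<in> ball 0 d" using that d by auto
    then have "((deriv ^^ i) \<phi> has_field_derivative deriv ((deriv ^^ i) \<phi>) x) (at x)"
      using holomorphic_higher_deriv[OF hol open_ball] by (intro holomorphic_derivI[of _ "ball 0 d"]) auto
    then show ?thesis by (auto intro: has_field_derivative_at_within)
  qed
  have B: "cmod ((deriv ^^ Suc 1) \<phi> x) \<le> 8 * (M + 1) / d\<^sup>2" if x: "x \<in> ball 0 (d/4)" for x
  proof -
    have sub: "cball x (d/2) \<subseteq> ball 0 d"
    proof
      fix y assume "y \<in> cball x (d/2)"
      then show "y \<in> ball 0 d" using x d norm_triangle_ineq[of "y - x" x]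
        by (auto simp: dist_norm norm_minus_commute)
    qed
    \<comment> \<open>The Cauchy estimate asks for values in an open ball, hence
      \<open>M + 1\<close> in place of \<open>M\<close>.\<close>
    have "cmod ((deriv ^^ 2) \<phi> x) \<le> fact 2 * (M + 1) / (d/2) ^ 2"
    proof (rule Cauchy_higher_deriv_bound[where y = 0])
      show "\<phi> holomorphic_on ball x (d/2)"
        using hol sub ball_subset_cball holomorphic_on_subset by blast
      show "continuous_on (cball x (d/2)) \<phi>"
        using holomorphic_on_imp_continuous_on[OF hol] sub continuous_on_subset by blast
      show "\<phi> w \<in> ball 0 (M + 1)" if "w \<in> ball x (d/2)" for w
        proof -
        have "w \<in> ball 0 d" using that sub ball_subset_cball by blast
        from M[OF this] show ?thesis by simp
      qed
    qed (use d in auto)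
    then show ?thesis by (simp add: numeral_2_eq_2[symmetric] power_divide)
  qed
  have "cmod ((deriv ^^ 0) \<phi> t - (\<Sum>i\<le>1. (deriv ^^ i) \<phi> 0 * (t - 0) ^ i / fact i))
        \<le> 8 * (M + 1) / d\<^sup>2 * cmod (t - 0) ^ Suc 1 / fact 1"
    by (rule complex_Taylor[where S = "ball 0 (d/4)" and f = "\<lambda>i. (deriv ^^ i) \<phi>"])
       (use D B d t in auto)
  then show ?thesis by (simp add: algebra_simps power2_eq_square)
qed

text \<open>The complex Jacobian matrix. Taking one-variable derivatives along coordinate lines
  presents each entry as a limit of difference quotients; \<open>matrix_eq_pdiff\<close> identifies
  it with the matrix of the Frechet derivative.\<close>

definition pdiff :: "(complex ^ 'n \<Rightarrow> complex ^ 'm) \<Rightarrow> complex ^ 'n \<Rightarrow> complex ^ 'n ^ 'm" where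
  "pdiff f z = (\<chi> i j. deriv (\<lambda>t. f (z + t *s axis j 1) $ i) 0)"

lemma matrix_eq_pdiff:
  fixes L :: "complex ^ 'n \<Rightarrow> complex ^ 'm"
  assumes L: "Vector_Spaces.linear (*s) (*s) L" and f: "(f has_derivative L) (at z)"
  shows "matrix L = pdiff f z"
proof -
  have "((\<lambda>t. f (z + t *s axis j 1) $ i) has_field_derivative L (axis j 1) $ i) (at 0)" for i j
    by (rule curve_component_field_derivative[OF
          clinear_curve_has_derivative[OF L _ affine_curve_has_derivative]]) (use f in simp)
  from DERIV_imp_deriv[OF this] show ?thesis by (simp add: matrix_def pdiff_def vec_eq_iff)
qed

text \<open>The one-variable Taylor bound along the \<open>j\<close>-th coordinate line has the same
  constant for all base points near \<open>z0\<close>, because \<open>f\<close> is bounded on a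
  compact ball. Locally uniform limits then transfer continuity and holomorphy to the partial
  derivatives.\<close>

lemma difference_quotients_uniform_limit:
  fixes f :: "complex ^ 'n \<Rightarrow> complex ^ 'm"
  assumes f: "cholomorphic_on f G" and G: "open G" "z0 \<in> G"
  obtains d where "d > 0" "\<And>z t. z \<in> ball z0 d \<Longrightarrow> cmod t < d \<Longrightarrow> z + t *s axis j 1 \<in> G"
    "uniform_limit (ball z0 d)
       (\<lambda>m z. of_nat m * (f (z + of_real (1 / real m) *s axis j 1) $ i - f z $ i))
       (\<lambda>z. pdiff f z $ i $ j) sequentially"
proof -
  obtain r where r: "r > 0" "cball z0 r \<subseteq> G" using G open_contains_cball by blast
  \<comment> \<open>Half of \<open>r\<close>: a base point within \<open>d\<close> of
    \<open>z0\<close> and an increment below \<open>d\<close> together stay in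
    \<open>cball z0 r\<close>.\<close>
  define d where "d = r / 2"
  have d: "d > 0" using r by (simp add: d_def)
  have in_cball: "z + t *s axis j 1 \<in> cball z0 r" if "z \<in> ball z0 d" "cmod t < d" for z t
  proof -
    have "norm (z + t *s axis j 1 - z0) \<le> norm (z - z0) + norm (t *s axis j (1::complex))"
      using norm_triangle_ineq[of "z - z0" "t *s axis j 1"] by (simp add: algebra_simps)
    then show ?thesis using that by (simp add: norm_smult dist_norm norm_minus_commute d_def)
  qed
  have inG: "z + t *s axis j 1 \<in> G" if "z \<in> ball z0 d" "cmod t < d" for z t
    using in_cball[OF that] r by blast
  have "continuous_on (cball z0 r) (\<lambda>z. f z $ i)"
    using cholomorphic_on_imp_continuous_on[OF f] r(2) continuous_on_subset
    by (blast intro: continuous_on_component)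
  then obtain M where M: "\<And>z. z \<in> cball z0 r \<Longrightarrow> cmod (f z $ i) \<le> M"
    using compact_continuous_image[OF _ compact_cball, THEN compact_imp_bounded, of z0 r "\<lambda>z. f z $ i"]
    unfolding bounded_iff by (meson imageI)
  have est: "cmod (of_nat m * (f (z + of_real (1 / real m) *s axis j 1) $ i - f z $ i) - pdiff f z $ i $ j)
        \<le> 8 * (M + 1) / d\<^sup>2 * (1 / real m)" if z: "z \<in> ball z0 d" and m: "1 / real m < d / 4" "m > 0" for z m
  proof -
    define \<phi> where "\<phi> = (\<lambda>t. f (z + t *s axis j 1) $ i)"
    have "\<phi> holomorphic_on ball 0 d"
    proof (rule holomorphic_onI, rule field_differentiable_at_within)
      fix t :: complex assume "t \<in> ball 0 d"
      then show "\<phi> field_differentiable at t"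
        using cholomorphic_curve[OF f inG[OF z, of t] affine_curve_has_derivative]
          curve_component_field_derivative unfolding \<phi>_def field_differentiable_def by fastforce
    qed
    from first_order_Taylor_bound[OF this d, of M "of_real (1 / real m)"]
    have "cmod (\<phi> (of_real (1 / real m)) - \<phi> 0 - deriv \<phi> 0 * of_real (1 / real m))
        \<le> 8 * (M + 1) / d\<^sup>2 * (1 / real m)\<^sup>2"
      using m M in_cball[OF z] by (auto simp: \<phi>_def norm_divide)
    \<comment> \<open>Scaling by \<open>m\<close> turns the quadratic remainder at
      \<open>t = 1/m\<close> into an error of order \<open>1/m\<close>.\<close>
    then have "real m * cmod (\<phi> (of_real (1 / real m)) - \<phi> 0 - deriv \<phi> 0 * of_real (1 / real m))
        \<le> real m * (8 * (M + 1) / d\<^sup>2 * (1 / real m)\<^sup>2)"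
      by (intro mult_left_mono) auto
    also have "\<dots> = 8 * (M + 1) / d\<^sup>2 * (1 / real m)" using m by (simp add: power2_eq_square)
    also have "real m * cmod (\<phi> (of_real (1 / real m)) - \<phi> 0 - deriv \<phi> 0 * of_real (1 / real m))
       = cmod (of_nat m * (\<phi> (of_real (1 / real m)) - \<phi> 0 - deriv \<phi> 0 * of_real (1 / real m)))"
      by (simp add: norm_mult)
    also have "of_nat m * (\<phi> (of_real (1 / real m)) - \<phi> 0 - deriv \<phi> 0 * of_real (1 / real m))
       = of_nat m * (\<phi> (of_real (1 / real m)) - \<phi> 0) - deriv \<phi> 0"
      using m by (simp add: algebra_simps)
    finally show ?thesis by (simp add: \<phi>_def pdiff_def)
  qed
  have "uniform_limit (ball z0 d)
       (\<lambda>m z. of_nat m * (f (z + of_real (1 / real m) *s axis j 1) $ i - f z $ i))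
       (\<lambda>z. pdiff f z $ i $ j) sequentially"
  proof (rule uniform_limitI)
    fix e :: real assume e: "e > 0"
    have l: "(\<lambda>m. 1 / real m) \<longlonglongrightarrow> 0" by (rule lim_1_over_n)
    then have "(\<lambda>m. 8 * (M + 1) / d\<^sup>2 * (1 / real m)) \<longlonglongrightarrow> 8 * (M + 1) / d\<^sup>2 * 0"
      by (intro tendsto_intros)
    then have "\<forall>\<^sub>F m in sequentially. 8 * (M + 1) / d\<^sup>2 * (1 / real m) < e"
      using e by (intro order_tendstoD) auto
    moreover have "\<forall>\<^sub>F m in sequentially. 1 / real m < d / 4"
      using l d by (intro order_tendstoD) auto
    ultimately show "\<forall>\<^sub>F m in sequentially. \<forall>z\<in>ball z0 d. dist
       (of_nat m * (f (z + of_real (1 / real m) *s axis j 1) $ i - f z $ i)) (pdiff f z $ i $ j) < e"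
      using eventually_gt_at_top[of 0]
    proof eventually_elim
      case (elim m)
      show ?case
      proof
        fix z assume "z \<in> ball z0 d"
        from est[OF this elim(2,3)] elim(1) show "dist
          (of_nat m * (f (z + of_real (1 / real m) *s axis j 1) $ i - f z $ i)) (pdiff f z $ i $ j) < e"
          unfolding dist_norm by linarith
      qed
    qed
  qed
  with that d inG show ?thesis by blast
qed

lemma continuous_on_pdiff:
  fixes f :: "complex ^ 'n \<Rightarrow> complex ^ 'm"
  assumes f: "cholomorphic_on f G" and G: "open G"
  shows "continuous_on G (\<lambda>z. pdiff f z $ i $ j)"
proof (rule continuous_at_imp_continuous_on, rule ballI)
  fix z0 assume "z0 \<in> G"
  then obtain d where d: "d > 0" "\<And>z t. z \<in> ball z0 d \<Longrightarrow> cmod t < d \<Longrightarrow> z + t *s axis j 1 \<in> G"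
    "uniform_limit (ball z0 d)
       (\<lambda>m z. of_nat m * (f (z + of_real (1 / real m) *s axis j 1) $ i - f z $ i))
       (\<lambda>z. pdiff f z $ i $ j) sequentially"
    using difference_quotients_uniform_limit[OF f G] by blast
  have cf: "continuous_on G f" by (rule cholomorphic_on_imp_continuous_on[OF f])
  have "\<forall>\<^sub>F m in sequentially. 1 / real m < d"
    using lim_1_over_n d(1) by (intro order_tendstoD) auto
  then have "\<forall>\<^sub>F m in sequentially. continuous_on (ball z0 d)
     (\<lambda>z. of_nat m * (f (z + of_real (1 / real m) *s axis j 1) $ i - f z $ i))"
  proof eventually_elim
    case (elim m)
    have "continuous_on (ball z0 d) (\<lambda>z. f (z + of_real (1 / real m) *s axis j 1))"
      using d elim by (intro continuous_on_compose2[OF cf] continuous_intros) (auto simp: norm_divide)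
    moreover have "continuous_on (ball z0 d) f"
      using d(2)[of _ 0] d(1) by (intro continuous_on_subset[OF cf]) auto
    ultimately show ?case by (intro continuous_on_mult continuous_on_diff continuous_on_component continuous_on_const)
  qed
  then have "continuous_on (ball z0 d) (\<lambda>z. pdiff f z $ i $ j)"
    using d(3) by (intro uniform_limit_theorem) auto
  then show "isCont (\<lambda>z. pdiff f z $ i $ j) z0"
    using d(1) by (simp add: continuous_on_eq_continuous_at)
qed

text \<open>Along a holomorphic curve the difference quotients are holomorphic in the curve
  parameter, and they converge uniformly on small closed discs; Weierstrass' theorem
  applies.\<close>

lemma pdiff_curve_holomorphic:
  fixes f :: "complex ^ 'n \<Rightarrow> complex ^ 'm"
  assumes f: "cholomorphic_on f G" and G: "open G" and S: "open S" "\<gamma> ` S \<subseteq> G"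
    and \<gamma>: "\<And>t. t \<in> S \<Longrightarrow> \<exists>v. (\<gamma> has_derivative (\<lambda>h. h *s v)) (at t)"
  shows "(\<lambda>t. pdiff f (\<gamma> t) $ i $ j) holomorphic_on S"
proof -
  have "(\<lambda>t. pdiff f (\<gamma> t) $ i $ j) field_differentiable at t0" if t0: "t0 \<in> S" for t0
  proof -
    have "\<gamma> t0 \<in> G" using S(2) t0 by blast
    then obtain d where d: "d > 0" "\<And>z t. z \<in> ball (\<gamma> t0) d \<Longrightarrow> cmod t < d \<Longrightarrow> z + t *s axis j 1 \<in> G"
      "uniform_limit (ball (\<gamma> t0) d)
         (\<lambda>m z. of_nat m * (f (z + of_real (1 / real m) *s axis j 1) $ i - f z $ i))
         (\<lambda>z. pdiff f z $ i $ j) sequentially"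
      using difference_quotients_uniform_limit[OF f G, where i = i and j = j] by blast
    have "continuous_on S \<gamma>"
    proof (rule continuous_at_imp_continuous_on, rule ballI)
      fix t assume "t \<in> S"
      then obtain v where "(\<gamma> has_derivative (\<lambda>h. h *s v)) (at t)" using \<gamma> by blast
      then show "isCont \<gamma> t" by (rule has_derivative_continuous)
    qed
    then have "open (S \<inter> \<gamma> -` ball (\<gamma> t0) d)" using S(1) by (intro continuous_open_preimage) auto
    moreover have "t0 \<in> S \<inter> \<gamma> -` ball (\<gamma> t0) d" using t0 d by simp
    ultimately obtain e where e: "e > 0" "ball t0 e \<subseteq> S \<inter> \<gamma> -` ball (\<gamma> t0) d"
      using open_contains_ball by blast
    \<comment> \<open>Every member of the sequence must be holomorphic, so the first
      \<open>N\<close> are dropped: beyond them the shifted points remain in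
      \<open>G\<close>.\<close>
    obtain N where N: "\<And>m. m \<ge> N \<Longrightarrow> 1 / real m < d"
      using order_tendstoD(2)[OF lim_1_over_n[where ?'a = real] d(1)] unfolding eventually_sequentially by blast
    define q where "q = (\<lambda>m t. of_nat m * (f (\<gamma> t + of_real (1 / real m) *s axis j 1) $ i - f (\<gamma> t) $ i))"
    have "(\<lambda>t. pdiff f (\<gamma> t) $ i $ j) holomorphic_on ball t0 e"
    proof (rule holomorphic_uniform_sequence[where f = "\<lambda>m. q (m + N)"])
      fix m
      show "q (m + N) holomorphic_on ball t0 e"
      proof (rule holomorphic_onI, rule field_differentiable_at_within)
        fix t assume t: "t \<in> ball t0 e"
        then have tS: "t \<in> S" and tb: "\<gamma> t \<in> ball (\<gamma> t0) d" using e by auto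
        obtain v where v: "(\<gamma> has_derivative (\<lambda>h. h *s v)) (at t)" using \<gamma>[OF tS] by blast
        define w where "w = of_real (1 / real (m + N)) *s (axis j 1 :: complex ^ 'n)"
        have "((\<lambda>t. \<gamma> t + w) has_derivative (\<lambda>h. h *s v)) (at t)"
          using has_derivative_add[OF v has_derivative_const[of w]] by simp
        moreover have "\<gamma> t + w \<in> G" unfolding w_def
        proof (rule d(2)[OF tb])
          show "cmod (of_real (1 / real (m + N))) < d"
            using N[of "m + N"] unfolding norm_of_real by simp
        qed
        ultimately have "\<exists>v'. ((\<lambda>t. f (\<gamma> t + w)) has_derivative (\<lambda>h. h *s v')) (at t)"
          using cholomorphic_curve[OF f, of "\<lambda>t. \<gamma> t + w"] by blast
        moreover have "\<exists>v'. ((\<lambda>t. f (\<gamma> t)) has_derivative (\<lambda>h. h *s v')) (at t)"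
          using cholomorphic_curve[OF f _ v] S(2) tS by blast
        ultimately have "(\<lambda>t. f (\<gamma> t + w) $ i) field_differentiable at t"
           "(\<lambda>t. f (\<gamma> t) $ i) field_differentiable at t"
          using curve_component_field_derivative unfolding field_differentiable_def by blast+
        then show "q (m + N) field_differentiable at t" unfolding q_def w_def
          by (intro derivative_intros)
      qed
    next
      fix t assume t: "t \<in> ball t0 e"
      then obtain r where r: "r > 0" "cball t r \<subseteq> ball t0 e" using open_contains_cball open_ball by blast
      have "uniform_limit (cball t r) (\<lambda>m t. q m t) (\<lambda>t. pdiff f (\<gamma> t) $ i $ j) sequentially"
        unfolding q_def
        by (rule uniform_limit_compose'[OF d(3)]) (use r e in auto)
      then have "uniform_limit (cball t r) (\<lambda>m. q (m + N)) (\<lambda>t. pdiff f (\<gamma> t) $ i $ j) sequentially"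
        by (rule filterlim_compose[OF _ filterlim_add_const_nat_at_top])
      then show "\<exists>r>0. cball t r \<subseteq> ball t0 e \<and>
          uniform_limit (cball t r) (\<lambda>m. q (m + N)) (\<lambda>t. pdiff f (\<gamma> t) $ i $ j) sequentially"
        using r by blast
    qed simp
    then show ?thesis using e(1) holomorphic_on_imp_differentiable_at[of _ "ball t0 e" t0] by simp
  qed
  then show ?thesis by (simp add: holomorphic_onI field_differentiable_at_within)
qed

lemma continuous_on_det_pdiff:
  assumes "cholomorphic_on f G" "open G"
  shows "continuous_on G (\<lambda>z. det (pdiff f z))"
  unfolding det_def by (intro continuous_intros continuous_on_pdiff[OF assms])

lemma det_pdiff_curve_holomorphic:
  assumes "cholomorphic_on f G" "open G" "open S" "\<gamma> ` S \<subseteq> G"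
    and "\<And>t. t \<in> S \<Longrightarrow> \<exists>v. (\<gamma> has_derivative (\<lambda>h. h *s v)) (at t)"
  shows "(\<lambda>t. det (pdiff f (\<gamma> t))) holomorphic_on S"
  unfolding det_def by (intro holomorphic_intros pdiff_curve_holomorphic[OF assms])

subsection \<open>The Schwarz lemma for inverses of injective maps\<close>

text \<open>If the Jacobian determinant vanished on all of \<open>U\<close>, the image would be
  negligible by Sard's theorem, yet open and nonempty by invariance of domain.\<close>

lemma cholomorphic_injective_det_nonzero:
  fixes f :: "complex ^ 'n \<Rightarrow> complex ^ 'n"
  assumes f: "cholomorphic_on f U" "inj_on f U" and U: "open U" "U \<noteq> {}"
  shows "\<exists>z\<in>U. det (pdiff f z) \<noteq> 0"
proof (rule ccontr)
  assume "\<not> (\<exists>z\<in>U. det (pdiff f z) \<noteq> 0)"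
  then have sing: "det (pdiff f z) = 0" if "z \<in> U" for z using that by blast
  have "\<forall>z\<in>U. \<exists>L. Vector_Spaces.linear (*s) (*s) L \<and> (f has_derivative L) (at z)"
    using f(1) by (simp add: cholomorphic_on_def)
  then obtain L where L: "\<And>z. z \<in> U \<Longrightarrow> Vector_Spaces.linear (*s) (*s) (L z)"
      "\<And>z. z \<in> U \<Longrightarrow> (f has_derivative L z) (at z)"
    by metis
  \<comment> \<open>Sard's theorem concerns real vectors. The index type \<open>'n bit0\<close> has
    twice as many elements as \<open>'n\<close>, matching the real dimension of complex
    \<open>n\<close>-space.\<close>
  obtain T :: "complex ^ 'n \<Rightarrow> real ^ 'n bit0" and T' where T: "linear T" "linear T'"
      "\<And>x. T' (T x) = x" "\<And>y. T (T' y) = y"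
    by (rule isomorphisms_UNIV_UNIV[where ?'M = "complex ^ 'n" and ?'N = "real ^ 'n bit0"]) auto
  have bT: "bounded_linear T" "bounded_linear T'" using T linear_conv_bounded_linear by blast+
  have "negligible ((T \<circ> f \<circ> T') ` (T ` U))"
  proof (rule baby_Sard[where f' = "\<lambda>y. T \<circ> L (T' y) \<circ> T'"])
    fix y assume "y \<in> T ` U"
    then have U': "T' y \<in> U" using T by auto
    have "(T \<circ> (f \<circ> T') has_derivative T \<circ> (L (T' y) \<circ> T')) (at y)"
      using L(2)[OF U'] bT by (intro diff_chain_at bounded_linear_imp_has_derivative) auto
    then show "(T \<circ> f \<circ> T' has_derivative T \<circ> L (T' y) \<circ> T') (at y within T ` U)"
      by (simp add: comp_assoc has_derivative_at_withinI)
    interpret lin: Vector_Spaces.linear "(*s)" "(*s)" "L (T' y)" by (rule L(1)[OF U'])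
    have mL: "matrix (L (T' y)) *v x = L (T' y) x" for x by (rule matrix_works[OF L(1)[OF U']])
    \<comment> \<open>A singular complex matrix has a nontrivial kernel, so the associated real map
      is not injective and has deficient rank.\<close>
    have "\<not> invertible (matrix (L (T' y)))"
      using sing[OF U'] matrix_eq_pdiff[OF L(1)[OF U'] L(2)[OF U']] invertible_det_nz by metis
    then have "\<not> inj (L (T' y))"
      using matrix_left_invertible_injective[of "matrix (L (T' y))"] invertible_left_inverse mL
      by (metis (no_types, lifting) ext)
    then obtain u v where uv: "u \<noteq> v" "L (T' y) u = L (T' y) v" by (auto simp: inj_def)
    have lin: "linear (T \<circ> L (T' y) \<circ> T')"
      using bounded_linear.linear[OF bounded_linear_clinear[OF L(1)[OF U']]] T
      by (simp add: linear_compose)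
    have "\<not> inj ((*v) (matrix (T \<circ> L (T' y) \<circ> T')))"
    proof
      assume "inj ((*v) (matrix (T \<circ> L (T' y) \<circ> T')))"
      moreover have "matrix (T \<circ> L (T' y) \<circ> T') *v (T u) = matrix (T \<circ> L (T' y) \<circ> T') *v (T v)"
        using uv T lin by (simp add: matrix_works)
      ultimately have "T u = T v" by (rule injD)
      then show False using uv T(3) by metis
    qed
    then show "rank (matrix (T \<circ> L (T' y) \<circ> T')) < CARD('n bit0)"
      by (rule less_rank_noninjective[THEN iffD2])
  qed simp
  moreover have "open ((T \<circ> f \<circ> T') ` (T ` U))"
  proof -
    have "open (f ` U)"
      using f U by (intro invariance_of_domain cholomorphic_on_imp_continuous_on)
    moreover have "range T = UNIV" using T(4) by (metis surjI)
    ultimately have "open (T ` (f ` U))" using T(1) open_surjective_linear_image by blast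
    moreover have "(T \<circ> f \<circ> T') ` (T ` U) = T ` (f ` U)" using T(3) by (auto simp: image_image)
    ultimately show ?thesis by simp
  qed
  ultimately show False using U(2) open_not_negligible by fastforce
qed

lemma clinear_inverse_exists:
  fixes L :: "complex ^ 'n \<Rightarrow> complex ^ 'n"
  assumes "Vector_Spaces.linear (*s) (*s) L" "det (matrix L) \<noteq> 0"
  shows "\<exists>M. Vector_Spaces.linear (*s) (*s) M \<and> L \<circ> M = id \<and> M \<circ> L = id"
  using assms matrix_invertible_gen[OF assms(1)] invertible_det_nz by blast

text \<open>Invariance of domain makes the inverse continuous, and a continuous inverse is
  differentiable wherever the derivative of \<open>f\<close> is invertible; the inverse of a complex
  linear map is complex linear.\<close>

lemma inverse_has_derivative:
  fixes f :: "complex ^ 'n \<Rightarrow> complex ^ 'n"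
  assumes f: "cholomorphic_on f G" "inj_on f G" and G: "open G" and w: "w \<in> f ` G"
    and det: "det (pdiff f (inv_into G f w)) \<noteq> 0"
  shows "\<exists>M. Vector_Spaces.linear (*s) (*s) M \<and> (inv_into G f has_derivative M) (at w)"
proof -
  have "inv_into G f w \<in> G" using w by (rule inv_into_into)
  then obtain L where L: "Vector_Spaces.linear (*s) (*s) L" "(f has_derivative L) (at (inv_into G f w))"
    using f(1) unfolding cholomorphic_on_def by blast
  obtain M where M: "Vector_Spaces.linear (*s) (*s) M" "M \<circ> L = id"
    using clinear_inverse_exists[OF L(1)] det matrix_eq_pdiff[OF L] by auto
  have cf: "continuous_on G f" by (rule cholomorphic_on_imp_continuous_on[OF f(1)])
  have op: "open (f ` G)" by (rule invariance_of_domain[OF cf G f(2)])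
  have "continuous_on (f ` G) (inv_into G f)"
    using G cf f(2) by (intro continuous_on_inverse_open) auto
  then have isc: "isCont (inv_into G f) w" using continuous_on_eq_continuous_at[OF op] w by blast
  have "(inv_into G f has_derivative M) (at w)"
    by (rule has_derivative_inverse_basic[where f = f and f' = L and g = "inv_into G f" and T = "f ` G"])
       (use isc L(2) M op w bounded_linear_clinear[OF M(1)] in \<open>simp_all add: f_inv_into_f\<close>)
  with M show ?thesis by blast
qed

text \<open>
  Only continuity of the inverse is known. It is holomorphic where the Jacobian determinant does not
  vanish, so the maximum principle is applied to difference quotients based at nearby regular points
  \<open>c\<close>, and then \<open>c\<close> tends to \<open>0\<close>.
\<close>

lemma inverse_Schwarz:
  fixes f :: "complex ^ 'n \<Rightarrow> complex ^ 'n"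
  assumes f: "cholomorphic_on f G" "inj_on f G" "f 0 = 0" and G: "open G" "0 \<in> G"
    and W: "open W" "balanced W" "W \<subseteq> f ` G" and w: "w \<in> W" and s: "0 < s" "s < 1"
    and a: "\<And>z. z \<in> G \<Longrightarrow> cmod (cpair a z) < 1"
  shows "cmod (cpair a (inv_into G f (of_real s *s w))) \<le> s"
proof -
  define g where "g = inv_into G f"
  define H where "H = (\<lambda>x. det (pdiff f (g x)))"
  have cf: "continuous_on G f" by (rule cholomorphic_on_imp_continuous_on[OF f(1)])
  have op: "open (f ` G)" by (rule invariance_of_domain[OF cf G(1) f(2)])
  have cg: "continuous_on (f ` G) g"
    unfolding g_def using G cf f(2) by (intro continuous_on_inverse_open) auto
  have gG: "g x \<in> G" if "x \<in> f ` G" for x unfolding g_def using that by (rule inv_into_into)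
  have fg: "f (g x) = x" if "x \<in> f ` G" for x unfolding g_def using that by (rule f_inv_into_f)
  have gf: "g (f z) = z" if "z \<in> G" for z unfolding g_def using f(2) that by (rule inv_into_f_f)
  have cH: "continuous_on (f ` G) H" unfolding H_def
    by (rule continuous_on_compose2[OF continuous_on_det_pdiff[OF f(1) G(1)] cg]) (use gG in auto)
  \<comment> \<open>Nonvanishing of \<open>H\<close> is dense in the image: restrict
    \<open>f\<close> to the preimage of \<open>U\<close> and apply the Sard argument there.\<close>
  have dense: "\<exists>x\<in>U. H x \<noteq> 0" if U: "open U" "U \<subseteq> f ` G" "U \<noteq> {}" for U
  proof -
    have "open (G \<inter> f -` U)" using cf G(1) U(1) by (intro continuous_open_preimage)
    moreover have "G \<inter> f -` U \<noteq> {}" using U by blast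
    moreover have "cholomorphic_on f (G \<inter> f -` U)" using f(1) by (simp add: cholomorphic_on_def)
    moreover have "inj_on f (G \<inter> f -` U)" using f(2) by (rule inj_on_subset) auto
    ultimately obtain z where "z \<in> G \<inter> f -` U" "det (pdiff f z) \<noteq> 0"
      using cholomorphic_injective_det_nonzero by blast
    then show ?thesis using gf by (intro bexI[of _ "f z"]) (auto simp: H_def)
  qed
  \<comment> \<open>The closed disc spanned by \<open>w\<close> is compact in \<open>W\<close>, so
    all its translates by a vector \<open>c\<close> shorter than some \<open>\<epsilon>\<close>
    still lie in \<open>W\<close>.\<close>
  define K where "K = (\<lambda>\<mu>. \<mu> *s w) ` cball (0::complex) 1"
  have "compact K" unfolding K_def
    by (intro compact_continuous_image compact_cball linear_continuous_on bounded_linear_smult_left)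
  moreover have "K \<subseteq> W" using W(2) w by (auto simp: K_def balanced_def)
  ultimately obtain \<epsilon> where \<epsilon>: "\<epsilon> > 0" "(\<Union>x\<in>K. ball x \<epsilon>) \<subseteq> W"
    using compact_subset_open_imp_ball_epsilon_subset W(1) by metis
  have inW: "c + \<mu> *s w \<in> W" if "norm c < \<epsilon>" "cmod \<mu> \<le> 1" for c \<mu>
  proof -
    have "c + \<mu> *s w \<in> ball (\<mu> *s w) \<epsilon>" using that by (simp add: dist_norm)
    moreover have "\<mu> *s w \<in> K" using that by (auto simp: K_def)
    ultimately show ?thesis using \<epsilon> by blast
  qed
  have bound: "cmod (cpair a (g (c + of_real s *s w)) - cpair a (g c)) \<le> s * (1 + cmod (cpair a (g c)))"
    if c: "norm c < \<epsilon>" "H c \<noteq> 0" "H (c + of_real s *s w) \<noteq> 0" for c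
  proof -
    define u where "u = (\<lambda>\<mu>. cpair a (g (c + \<mu> *s w)))"
    define h where "h = (\<lambda>\<mu>. H (c + \<mu> *s w))"
    define \<Omega> where "\<Omega> = {\<mu>\<in>ball 0 1. h \<mu> \<noteq> 0}"
    have inV: "c + \<mu> *s w \<in> f ` G" if "cmod \<mu> \<le> 1" for \<mu>
      using inW[OF c(1) that] W(3) by blast
    have caff: "continuous_on S (\<lambda>\<mu>. c + \<mu> *s w)" for S
      by (intro continuous_intros linear_continuous_on bounded_linear_smult_left)
    have cu: "continuous_on (cball 0 1) u" unfolding u_def
      by (intro continuous_intros continuous_on_compose2[OF cg caff]) (use inV in auto)
    have ch: "continuous_on (cball 0 1) h" unfolding h_def
      by (intro continuous_on_compose2[OF cH caff]) (use inV in auto)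
    have "open (ball 0 1 \<inter> h -` (- {0}))"
      using continuous_on_subset[OF ch ball_subset_cball] by (intro continuous_open_preimage) auto
    moreover have "ball 0 1 \<inter> h -` (- {0}) = \<Omega>" by (auto simp: \<Omega>_def)
    ultimately have op\<Omega>: "open \<Omega>" by simp
    have der: "\<exists>v. ((\<lambda>\<mu>. g (c + \<mu> *s w)) has_derivative (\<lambda>h. h *s v)) (at \<mu>)" if "\<mu> \<in> \<Omega>" for \<mu>
    proof -
      have "c + \<mu> *s w \<in> f ` G" "det (pdiff f (inv_into G f (c + \<mu> *s w))) \<noteq> 0"
        using that inV by (auto simp: \<Omega>_def h_def H_def g_def)
      from inverse_has_derivative[OF f(1,2) G(1) this] obtain M where
        "Vector_Spaces.linear (*s) (*s) M" "(g has_derivative M) (at (c + \<mu> *s w))"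
        unfolding g_def by blast
      from clinear_curve_has_derivative[OF this affine_curve_has_derivative] show ?thesis by blast
    qed
    have hol_h: "h holomorphic_on \<Omega>" unfolding h_def H_def
      by (rule det_pdiff_curve_holomorphic[OF f(1) G(1) op\<Omega> _ der]) (use inV gG in \<open>auto simp: \<Omega>_def\<close>)
    have hol_u: "u holomorphic_on \<Omega>"
    proof (rule holomorphic_onI, rule field_differentiable_at_within)
      fix \<mu> assume "\<mu> \<in> \<Omega>"
      then obtain v where "((\<lambda>\<mu>. g (c + \<mu> *s w)) has_derivative (\<lambda>h. h *s v)) (at \<mu>)" using der by blast
      from cpair_has_field_derivative[OF this] show "u field_differentiable at \<mu>"
        unfolding u_def field_differentiable_def by blast
    qed
    have 0: "0 \<in> \<Omega>" using c(2) by (simp add: \<Omega>_def h_def)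
    \<comment> \<open>The difference quotient of \<open>u\<close> at 0, with its singularity
      removed. As \<open>c\<close> is a regular point, \<open>u\<close> is holomorphic near 0 and
      \<open>v\<close> is holomorphic on \<open>\<Omega>\<close>.\<close>
    define v where "v = (\<lambda>\<mu>. if \<mu> = 0 then deriv u 0 else (u \<mu> - u 0) / (\<mu> - 0))"
    have hol_v: "v holomorphic_on \<Omega>" unfolding v_def
      by (rule pole_lemma[OF hol_u]) (use 0 op\<Omega> in \<open>simp add: interior_open\<close>)
    have cv: "continuous_on (cball 0 1) v"
    proof -
      \<comment> \<open>Continuity on the closed disc is glued from two relatively open pieces:
        \<open>\<Omega>\<close>, which contains 0, and the disc punctured at 0, where the quotient
        formula is continuous.\<close>
      have eq: "\<Omega> \<union> (cball 0 1 - {0}) = cball 0 1" using 0 by (auto simp: \<Omega>_def)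
      have "continuous_on (cball 0 1 - {0}) (\<lambda>\<mu>. (u \<mu> - u 0) / (\<mu> - 0))"
        by (intro continuous_intros continuous_on_subset[OF cu]) auto
      then have "continuous_on (cball 0 1 - {0}) v"
        by (rule continuous_on_eq) (auto simp: v_def)
      moreover have "openin (top_of_set (cball 0 1)) \<Omega>"
        using op\<Omega> by (rule open_subset[rotated]) (auto simp: \<Omega>_def)
      moreover have "openin (top_of_set (cball 0 1)) (cball 0 1 - {0::complex})"
        by (intro openin_diff) auto
      ultimately have "continuous_on (\<Omega> \<union> (cball 0 1 - {0})) v"
        using holomorphic_on_imp_continuous_on[OF hol_v]
        by (intro continuous_on_Un_local_open) (auto simp only: eq)
      then show ?thesis by (simp only: eq)
    qed
    have a1: "cmod (u \<mu>) < 1" if "cmod \<mu> \<le> 1" for \<mu>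
      using a[OF gG[OF inV[OF that]]] by (simp add: u_def)
    have "cmod (v (of_real s)) \<le> 1 + cmod (u 0)"
    proof (rule maximum_modulus_off_zeros[OF cv ch])
      show "v holomorphic_on {z \<in> ball 0 1. h z \<noteq> 0}" "h holomorphic_on {z \<in> ball 0 1. h z \<noteq> 0}"
        using hol_v hol_h by (simp_all add: \<Omega>_def)
      show "0 < 1 + cmod (u 0)" by (simp add: add_pos_nonneg)
      show "cmod (v z) \<le> 1 + cmod (u 0)" if "cmod z = 1" for z
        using that a1[of z] norm_triangle_ineq4[of "u z" "u 0"]
        by (auto simp: v_def norm_divide)
      show "of_real s \<in> ball (0::complex) 1" using s by simp
      show "h (of_real s) \<noteq> 0" using c(3) by (simp add: h_def)
    qed
    then show ?thesis using s by (simp add: v_def u_def norm_divide field_simps)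
  qed
  have "\<exists>c. norm c < min \<epsilon> (inverse (Suc n)) \<and> H c \<noteq> 0 \<and> H (c + of_real s *s w) \<noteq> 0" for n
  proof -
    define e where "e = min \<epsilon> (inverse (Suc n))"
    have e: "e > 0" "e \<le> \<epsilon>" using \<epsilon> by (auto simp: e_def)
    have sub: "ball 0 e \<subseteq> f ` G" using inW[of _ 0] e W(3) by force
    \<comment> \<open>Both \<open>c\<close> and \<open>c + of_real s *s w\<close> must be regular.
      The regular points near 0 form a nonempty open set, and by density its translate by
      \<open>of_real s *s w\<close> contains a regular point as well.\<close>
    define O1 where "O1 = ball 0 e \<inter> H -` (- {0})"
    have O1: "open O1" unfolding O1_def
      using cH sub continuous_on_subset by (intro continuous_open_preimage) auto
    obtain c0 where "c0 \<in> O1" using dense[of "ball 0 e"] sub e by (auto simp: O1_def)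
    have "open ((+) (of_real s *s w) ` O1)" using O1 by (rule open_translation)
    moreover have "(+) (of_real s *s w) ` O1 \<subseteq> f ` G"
    proof
      fix x assume "x \<in> (+) (of_real s *s w) ` O1"
      then obtain c where "c \<in> O1" "x = c + of_real s *s w" by (auto simp: add.commute)
      then show "x \<in> f ` G" using inW[of c "of_real s"] W(3) e s by (auto simp: O1_def)
    qed
    ultimately obtain x where "x \<in> (+) (of_real s *s w) ` O1" "H x \<noteq> 0"
      using dense \<open>c0 \<in> O1\<close> by (metis empty_iff image_is_empty)
    then obtain c where "c \<in> O1" "H (c + of_real s *s w) \<noteq> 0" by (auto simp: add.commute)
    then show ?thesis by (intro exI[of _ c]) (auto simp: O1_def e_def)
  qed
  then obtain c where c: "\<And>n. norm (c n) < min \<epsilon> (inverse (Suc n))" "\<And>n. H (c n) \<noteq> 0"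
    "\<And>n. H (c n + of_real s *s w) \<noteq> 0" by metis
  have c0: "c \<longlonglongrightarrow> 0"
  proof (rule tendsto_norm_zero_cancel, rule tendsto_sandwich[of "\<lambda>_. 0"])
    show "(\<lambda>n. inverse (real (Suc n))) \<longlonglongrightarrow> 0" by (rule LIMSEQ_inverse_real_of_nat)
    show "\<forall>\<^sub>F n in sequentially. norm (c n) \<le> inverse (real (Suc n))"
      using c(1) by (intro always_eventually allI) (meson less_imp_le min_less_iff_conj)
  qed auto
  have V0: "0 \<in> f ` G" "of_real s *s w \<in> f ` G"
    using inW[of 0 0] inW[of 0 "of_real s"] \<epsilon> s W(3) by auto
  have isc: "isCont g 0" "isCont g (of_real s *s w)"
    using cg continuous_on_eq_continuous_at[OF op] V0 by blast+
  have l1: "(\<lambda>n. g (c n)) \<longlonglongrightarrow> g 0" by (rule isCont_tendsto_compose[OF isc(1) c0])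
  have "(\<lambda>n. c n + of_real s *s w) \<longlonglongrightarrow> 0 + of_real s *s w" by (intro tendsto_intros c0)
  then have l2: "(\<lambda>n. g (c n + of_real s *s w)) \<longlonglongrightarrow> g (of_real s *s w)"
    using isCont_tendsto_compose[OF isc(2)] by simp
  have "cmod (cpair a (g (of_real s *s w)) - cpair a (g 0)) \<le> s * (1 + cmod (cpair a (g 0)))"
  proof (rule LIMSEQ_le)
    show "(\<lambda>n. cmod (cpair a (g (c n + of_real s *s w)) - cpair a (g (c n))))
       \<longlonglongrightarrow> cmod (cpair a (g (of_real s *s w)) - cpair a (g 0))"
      by (intro tendsto_intros l1 l2)
    show "(\<lambda>n. s * (1 + cmod (cpair a (g (c n))))) \<longlonglongrightarrow> s * (1 + cmod (cpair a (g 0)))"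
      by (intro tendsto_intros l1)
    show "\<exists>N. \<forall>n\<ge>N. cmod (cpair a (g (c n + of_real s *s w)) - cpair a (g (c n)))
       \<le> s * (1 + cmod (cpair a (g (c n))))"
      using c by (intro exI[of _ 0] allI impI bound) (auto dest: less_le_trans simp: min_less_iff_conj)
  qed
  \<comment> \<open>With \<open>g 0 = 0\<close> the limiting bound
    \<open>s * (1 + cmod (cpair a (g 0)))\<close> collapses to \<open>s\<close>.\<close>
  moreover have "g 0 = 0" using gf[OF G(2)] f(3) by simp
  ultimately show ?thesis by (simp add: g_def)
qed

section \<open>Linearisation at the origin of injective maps between balanced convex domains\<close>

lemma balanced_zero: "balanced G \<Longrightarrow> G \<noteq> {} \<Longrightarrow> 0 \<in> G"
  unfolding balanced_def by (metis equals0I norm_zero vector_smult_lzero zero_le_one)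

lemma open_scale_up:
  assumes "open G" "z \<in> G"
  obtains r where "r > 1" "of_real r *s z \<in> (G :: (complex ^ 'n) set)"
proof -
  have "open ((\<lambda>r::real. r *\<^sub>R z) -` G)"
    using assms(1) by (intro open_vimage) (auto intro: continuous_intros)
  moreover have "1 \<in> (\<lambda>r::real. r *\<^sub>R z) -` G" using assms(2) by simp
  ultimately obtain e where e: "e > 0" "ball 1 e \<subseteq> (\<lambda>r::real. r *\<^sub>R z) -` G"
    using open_contains_ball by blast
  have "1 + e / 2 \<in> ball 1 e" using e by (simp add: dist_real_def)
  then show ?thesis using that[of "1 + e / 2"] e by (auto simp: scaleR_vec_eq_smult)
qed

text \<open>If \<open>L z\<close> were outside \<open>G2\<close>, a separating functional composed
  with \<open>f\<close> along the disc through \<open>of_real r *s z\<close> would be a self-map of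
  the unit disc fixing 0. The Schwarz lemma bounds its derivative \<open>r * cpair a (L z)\<close>
  by 1, which the slack \<open>r > 1\<close> contradicts.\<close>

lemma derivative_at_zero_maps_into:
  fixes f :: "complex ^ 'n \<Rightarrow> complex ^ 'm"
  assumes f: "cholomorphic_on f G1" "f ` G1 \<subseteq> G2" "f 0 = 0"
    and L: "Vector_Spaces.linear (*s) (*s) L" "(f has_derivative L) (at 0)"
    and G1: "open G1" "balanced G1" and G2: "open G2" "balanced G2" "convex G2" and z: "z \<in> G1"
  shows "L z \<in> G2"
proof (rule ccontr)
  assume n: "L z \<notin> G2"
  have "G2 \<noteq> {}" using f(2) z by blast
  from balanced_convex_separation[OF G2 this n] obtain a where
    a: "\<And>z. z \<in> G2 \<Longrightarrow> cmod (cpair a z) < 1" "1 \<le> cmod (cpair a (L z))" by blast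
  obtain r where r: "r > 1" "of_real r *s z \<in> G1" using open_scale_up[OF G1(1) z] by blast
  define \<phi> where "\<phi> = (\<lambda>t. cpair a (f (0 + t *s (of_real r *s z))))"
  have inG: "t *s (of_real r *s z) \<in> G1" if "cmod t < 1" for t
    using G1(2) r(2) that unfolding balanced_def by (metis less_imp_le)
  have "\<phi> holomorphic_on ball 0 1"
  proof (rule holomorphic_onI, rule field_differentiable_at_within)
    fix t :: complex assume "t \<in> ball 0 1"
    then have "0 + t *s (of_real r *s z) \<in> G1" using inG by simp
    from cholomorphic_curve[OF f(1) this affine_curve_has_derivative] obtain v where
      "((\<lambda>t. f (0 + t *s (of_real r *s z))) has_derivative (\<lambda>h. h *s v)) (at t)" by blast
    from cpair_has_field_derivative[OF this] show "\<phi> field_differentiable at t"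
      unfolding \<phi>_def field_differentiable_def by blast
  qed
  moreover have "\<phi> 0 = 0" by (simp add: \<phi>_def f(3))
  moreover have "cmod (\<phi> t) < 1" if "cmod t < 1" for t
    using inG[OF that] f(2) a(1) by (auto simp: \<phi>_def)
  ultimately have le: "cmod (deriv \<phi> 0) \<le> 1" by (rule Schwarz_Lemma(2)[where \<xi> = 0]) auto
  have "((\<lambda>t. f (0 + t *s (of_real r *s z))) has_derivative (\<lambda>h. h *s L (of_real r *s z))) (at 0)"
    by (rule clinear_curve_has_derivative[OF L(1) _ affine_curve_has_derivative]) (use L(2) in simp)
  from cpair_has_field_derivative[OF this, of a] have "deriv \<phi> 0 = cpair a (L (of_real r *s z))"
    unfolding \<phi>_def by (rule DERIV_imp_deriv)
  also have "\<dots> = of_real r * cpair a (L z)"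
  proof -
    interpret Vector_Spaces.linear "(*s)" "(*s)" L by (rule L(1))
    show ?thesis by (simp add: scale)
  qed
  finally have "r * cmod (cpair a (L z)) \<le> 1" using le r(1) by (simp add: norm_mult)
  moreover have "r * 1 \<le> r * cmod (cpair a (L z))" using r(1) a(2) by (intro mult_left_mono) auto
  ultimately show False using r(1) by linarith
qed

text \<open>The Schwarz lemma for the inverse keeps the preimage of \<open>of_real s *s w\<close>,
  divided by \<open>s\<close>, inside \<open>G\<close>. As \<open>s\<close> tends to 0,
  \<open>L\<close> maps these points ever closer to \<open>w\<close>; compactness of
  \<open>closure G\<close> finishes.\<close>

lemma derivative_at_zero_covers:
  fixes f :: "complex ^ 'n \<Rightarrow> complex ^ 'n"
  assumes f: "cholomorphic_on f G" "inj_on f G" "f 0 = 0"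
    and L: "Vector_Spaces.linear (*s) (*s) L" "(f has_derivative L) (at 0)"
    and G: "open G" "balanced G" "convex G" "bounded G" "G \<noteq> {}"
    and W: "open W" "balanced W" "W \<subseteq> f ` G" and w: "w \<in> W"
  shows "w \<in> L ` closure G"
proof -
  have 0: "0 \<in> G" using balanced_zero G by blast
  interpret lin: Vector_Spaces.linear "(*s)" "(*s)" L by (rule L(1))
  obtain R where R: "R > 0" "\<And>z. z \<in> G \<Longrightarrow> norm z \<le> R"
    using G(4) unfolding bounded_pos by blast
  obtain r where r: "r > 1" "of_real r *s w \<in> W" using open_scale_up[OF W(1) w] by blast
  have y: "of_real (1 / s) *s inv_into G f (of_real s *s w) \<in> G" if s: "0 < s" "s < 1" for s
  proof (rule ccontr)
    let ?y = "of_real (1 / s) *s inv_into G f (of_real s *s w)"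
    assume n: "?y \<notin> G"
    from balanced_convex_separation[OF G(1-3) G(5) n] obtain a where
      a: "\<And>z. z \<in> G \<Longrightarrow> cmod (cpair a z) < 1" "1 \<le> cmod (cpair a ?y)" by blast
    \<comment> \<open>Applying the inverse Schwarz lemma to \<open>of_real r *s w\<close> at radius
      \<open>s / r\<close> gives a bound strictly below \<open>s\<close>.\<close>
    have "s / r < 1" using s r(1) by (simp add: field_simps)
    moreover have "0 < s / r" using s r(1) by simp
    ultimately have "cmod (cpair a (inv_into G f (of_real (s / r) *s (of_real r *s w)))) \<le> s / r"
      using inverse_Schwarz[OF f G(1) 0 W r(2) _ _ a(1)] by blast
    also have "of_real (s / r) *s (of_real r *s w) = of_real s *s w"
      using r(1) by (simp add: vector_smult_assoc)
    finally have "cmod (cpair a (inv_into G f (of_real s *s w))) \<le> s / r" .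
    moreover have "s \<le> cmod (cpair a (inv_into G f (of_real s *s w)))"
      using a(2) s by (simp add: norm_mult norm_divide field_simps)
    ultimately have "s \<le> s / r" by linarith
    then show False using s r(1) by (simp add: field_simps)
  qed
  have "w \<in> closure (L ` G)"
    unfolding closure_approachable
  proof (intro allI impI)
    fix e :: real assume e: "e > 0"
    have "\<forall>e>0. \<exists>d>0. \<forall>y. norm (y - 0) < d \<longrightarrow> norm (f y - f 0 - L (y - 0)) \<le> e * norm (y - 0)"
      using L(2) unfolding has_derivative_at_alt by blast
    then obtain d where d: "d > 0" "\<And>x. norm x < d \<Longrightarrow> norm (f x - L x) \<le> e / (2 * R) * norm x"
      using e R(1) f(3) by (metis (no_types, lifting) diff_zero divide_pos_pos mult_pos_pos zero_less_numeral)
    \<comment> \<open>Preimages of \<open>of_real s *s w\<close> have norm at most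
      \<open>s * R\<close>; this choice puts them below \<open>d\<close>, where the linear
      approximation is accurate, and keeps \<open>s < 1\<close>.\<close>
    define s where "s = min (1/2) (d / (2 * R))"
    have s: "0 < s" "s < 1" "s * R < d" using d(1) R(1) by (auto simp: s_def min_def field_simps)
    define x where "x = inv_into G f (of_real s *s w)"
    define y where "y = of_real (1 / s) *s x"
    have xy: "x = of_real s *s y" using s by (simp add: y_def vector_smult_assoc)
    have yG: "y \<in> G" unfolding y_def x_def by (rule y[OF s(1,2)])
    have "of_real s *s w \<in> f ` G" using W(2,3) w s unfolding balanced_def by (force simp: subset_iff)
    then have fx: "f x = of_real s *s w" unfolding x_def by (rule f_inv_into_f)
    have nx: "norm x \<le> s * R" unfolding xy norm_smult using R(2)[OF yG] s by simp
    have "s * norm (w - L y) = norm (of_real s *s (w - L y))" using s unfolding norm_smult by simp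
    also have "of_real s *s (w - L y) = f x - L x"
      unfolding fx by (simp add: xy lin.scale vector_sub_rdistrib vector_ssub_ldistrib)
    also have "norm (f x - L x) \<le> e / (2 * R) * norm x" using nx s(3) by (intro d(2)) linarith
    also have "\<dots> \<le> e / (2 * R) * (s * R)" using nx e R(1) by (intro mult_left_mono) auto
    also have "\<dots> = s * (e / 2)" using R(1) by simp
    finally have "norm (w - L y) \<le> e / 2" using s(1) by simp
    then have "dist (L y) w < e" using e by (simp add: dist_norm norm_minus_commute)
    then show "\<exists>y\<in>L ` G. dist y w < e" using yG by blast
  qed
  moreover have "closure (L ` G) \<subseteq> L ` closure G"
  proof (rule closure_minimal)
    show "L ` G \<subseteq> L ` closure G" using closure_subset by blast
    show "closed (L ` closure G)" using G(4)
      by (intro compact_imp_closed compact_continuous_image linear_continuous_on bounded_linear_clinear L(1))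
         (simp add: compact_closure)
  qed
  ultimately show ?thesis by blast
qed

lemma balanced_scaleR: "balanced G \<Longrightarrow> balanced ((*\<^sub>R) t ` G)"
  unfolding balanced_def by (force simp: scaleR_vec_eq_smult vector_smult_assoc mult.commute)

lemma linear_sandwich:
  fixes f :: "complex ^ 'n \<Rightarrow> complex ^ 'n"
  assumes f: "f \<in> inj_hol G1 G2" "f 0 = 0"
    and G1: "open G1" "balanced G1" "convex G1" "bounded G1" "G1 \<noteq> {}"
    and G2: "open G2" "balanced G2" "convex G2"
    and t: "t > 0" "(*\<^sub>R) t ` G2 \<subseteq> f ` G1"
  shows "\<exists>L M. Vector_Spaces.linear (*s) (*s) L \<and> Vector_Spaces.linear (*s) (*s) M \<and>
    (\<forall>x. L (M x) = x) \<and> (\<forall>x. M (L x) = x) \<and> L ` G1 \<subseteq> G2 \<and> (*\<^sub>R) t ` G2 \<subseteq> L ` G1"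
proof -
  have f': "cholomorphic_on f G1" "inj_on f G1" "f ` G1 \<subseteq> G2" using f(1) by (auto simp: inj_hol_def)
  have 0: "0 \<in> G1" "0 \<in> G2" using balanced_zero[OF G1(2,5)] f' f(2) by force+
  obtain L where L: "Vector_Spaces.linear (*s) (*s) L" "(f has_derivative L) (at 0)"
    using f'(1) 0 unfolding cholomorphic_on_def by blast
  define W where "W = (*\<^sub>R) t ` G2"
  have W: "open W" "balanced W" "W \<subseteq> f ` G1"
    using t G2 by (auto simp: W_def intro: open_scaling balanced_scaleR)
  have cover: "W \<subseteq> L ` closure G1"
    using derivative_at_zero_covers[OF f'(1,2) f(2) L G1 W] by blast
  have bl: "bounded_linear L" by (rule bounded_linear_clinear[OF L(1)])
  \<comment> \<open>The range of \<open>L\<close> contains a ball about 0, and every vector is a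
    multiple of one in that ball.\<close>
  have "surj L"
  proof -
    have "0 \<in> W" using 0 by (force simp: W_def)
    then obtain e where e: "e > 0" "ball 0 e \<subseteq> W" using W(1) open_contains_ball by blast
    have "x \<in> range L" for x
    proof -
      define c where "c = e / (2 * (norm x + 1))"
      have c: "c > 0" using e(1) by (simp add: c_def add_nonneg_pos)
      have "c * norm x < e" 
      proof -
        have "e * norm x < e * (2 * (norm x + 1))"
          using e(1) by (intro mult_strict_left_mono) (simp_all add: add_nonneg_pos)
        moreover have "0 < 2 * (norm x + 1)" by (simp add: add_nonneg_pos)
        ultimately show ?thesis by (simp only: c_def times_divide_eq_left pos_divide_less_eq)
      qed
      then have "c *\<^sub>R x \<in> ball 0 e" using c by simp
      then obtain y where "c *\<^sub>R x = L y" using e cover by blast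
      then have "x = L (inverse c *\<^sub>R y)"
        using c by (simp add: linear_cmul[OF bounded_linear.linear[OF bl]] flip: \<open>c *\<^sub>R x = L y\<close>)
      then show ?thesis by blast
    qed
    then show ?thesis by blast
  qed
  then obtain N where "L \<circ> N = id" "Vector_Spaces.linear (*s) (*s) N"
    using vec.linear_surjective_right_inverse[OF L(1)] by blast
  then have "invertible (matrix L)"
    using matrix_right_invertible_gen[OF L(1)] invertible_right_inverse by blast
  then obtain M where M: "Vector_Spaces.linear (*s) (*s) M" "L \<circ> M = id" "M \<circ> L = id"
    using matrix_invertible_gen[OF L(1)] by blast
  have LM: "L (M x) = x" "M (L x) = x" for x using M by (simp_all add: pointfree_idE)
  \<comment> \<open>Covering was obtained only with \<open>closure G1\<close>. Since
    \<open>M\<close> maps \<open>W\<close> to an open set, that image lies in the interior of the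
    closure, which for an open convex set is the set itself.\<close>
  have "M ` W \<subseteq> G1"
  proof -
    have "open (M ` W)"
      using LM by (intro open_surjective_linear_image W bounded_linear.linear bounded_linear_clinear M(1))
        (metis surjI)
    moreover have "M ` W \<subseteq> closure G1" using cover LM(2) by (auto dest: subsetD)
    ultimately have "M ` W \<subseteq> interior (closure G1)" by (simp add: interior_maximal)
    then show ?thesis using G1 by (simp add: convex_interior_closure interior_open)
  qed
  then have "W \<subseteq> L ` G1" by (metis LM(1) image_eqI image_subset_iff subsetI)
  moreover have "L ` G1 \<subseteq> G2"
    using derivative_at_zero_maps_into[OF f'(1,3) f(2) L G1(1,2) G2] by blast
  ultimately show ?thesis using L(1) M(1) LM by (intro exI[of _ L] exI[of _ M]) (simp add: W_def)
qed

subsection \<open>The Kobayashi distance and the two invariants\<close>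

lemma artanh_mono:
  assumes "-1 < x" "x \<le> y" "y < (1::real)" shows "artanh x \<le> artanh y"
  using assms by (simp add: artanh_def frac_le)

lemma artanh_strict_mono:
  assumes "-1 < x" "x < y" "y < (1::real)" shows "artanh x < artanh y"
  using assms by (simp add: artanh_def frac_less)

lemma artanh_nonneg: "0 \<le> x \<Longrightarrow> x < (1::real) \<Longrightarrow> 0 \<le> artanh x"
  using artanh_mono[of 0 x] by simp

lemma tanh_artanh:
  assumes "-1 < t" "t < (1::real)" shows "tanh (artanh t) = t"
proof -
  have "exp (- 2 * artanh t) = inverse ((1 + t) / (1 - t))"
    using assms by (simp add: artanh_def exp_minus)
  also have "\<dots> = (1 - t) / (1 + t)" by simp
  finally have "tanh (artanh t) = (1 - (1 - t) / (1 + t)) / (1 + (1 - t) / (1 + t))"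
    unfolding tanh_real_altdef by simp
  also have "\<dots> = t" using assms by (simp add: field_simps)
  finally show ?thesis .
qed

lemma artanh_add:
  assumes "0 \<le> x" "x < (1::real)" "0 \<le> y" "y < 1"
  shows "artanh ((x + y) / (1 + x * y)) = artanh x + artanh y"
proof -
  have p: "1 + x * y > 0" using assms by (simp add: add_pos_nonneg)
  have "1 + (x + y) / (1 + x * y) = (1 + x) * (1 + y) / (1 + x * y)"
       "1 - (x + y) / (1 + x * y) = (1 - x) * (1 - y) / (1 + x * y)"
    using p by (simp_all add: field_simps)
  then have "(1 + (x + y) / (1 + x * y)) / (1 - (x + y) / (1 + x * y))
      = ((1 + x) / (1 - x)) * ((1 + y) / (1 - y))"
    using p by simp
  moreover have "ln ((1 + x) / (1 - x) * ((1 + y) / (1 - y))) = ln ((1 + x) / (1 - x)) + ln ((1 + y) / (1 - y))"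
    using assms by (intro ln_mult_pos) auto
  ultimately show ?thesis by (simp only: artanh_def add_divide_distrib)
qed

text \<open>After squaring, the right side minus the left is
  \<open>2 * (r * q - c) * ((1 - r\<^sup>2) * (1 - q\<^sup>2))\<close>, nonnegative because
  \<open>c\<close>, the real part of \<open>cnj x * y\<close>, is at most
  \<open>r * q\<close>.\<close>

lemma norm_add_le_pseudohyperbolic:
  assumes "cmod x < 1" "cmod y < 1"
  shows "cmod (x + y) * (1 + cmod x * cmod y) \<le> (cmod x + cmod y) * cmod (1 + cnj x * y)"
proof (rule power2_le_imp_le)
  define r q c where "r = cmod x" and "q = cmod y" and "c = Re (cnj x * y)"
  have rq: "0 \<le> r" "r < 1" "0 \<le> q" "q < 1" using assms by (auto simp: r_def q_def)
  have cle: "c \<le> r * q" unfolding c_def r_def q_def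
    using complex_Re_le_cmod[of "cnj x * y"] by (simp add: norm_mult)
  have 1: "(cmod (x + y))\<^sup>2 = r\<^sup>2 + q\<^sup>2 + 2 * c"
    unfolding r_def q_def c_def cmod_power2 by (simp add: power2_eq_square algebra_simps)
  have 2: "(cmod (1 + cnj x * y))\<^sup>2 = 1 + 2 * c + r\<^sup>2 * q\<^sup>2"
    unfolding r_def q_def c_def cmod_power2 by (simp add: power2_eq_square algebra_simps)
  have "(r + q)\<^sup>2 * (1 + 2 * c + r\<^sup>2 * q\<^sup>2) - (r\<^sup>2 + q\<^sup>2 + 2 * c) * (1 + r * q)\<^sup>2
     = 2 * (r * q - c) * ((1 - r\<^sup>2) * (1 - q\<^sup>2))"
    by (simp add: power2_eq_square algebra_simps)
  also have "\<dots> \<ge> 0"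
    using cle rq by (intro mult_nonneg_nonneg) (auto simp: power_le_one)
  finally show "(cmod (x + y) * (1 + cmod x * cmod y))\<^sup>2 \<le> ((cmod x + cmod y) * cmod (1 + cnj x * y))\<^sup>2"
    unfolding power_mult_distrib 1 2 by (simp add: r_def q_def)
qed simp

lemma poincare_dist_Moebius: "poincare_dist a b = artanh (cmod (Moebius_function 0 a b))"
  by (simp add: poincare_dist_def Moebius_function_simple norm_divide norm_minus_commute)

lemma poincare_dist_nonneg:
  "cmod a < 1 \<Longrightarrow> cmod b < 1 \<Longrightarrow> 0 \<le> poincare_dist a b"
  unfolding poincare_dist_Moebius by (intro artanh_nonneg Moebius_function_norm_lt_1) auto

text \<open>The triangle inequality of the Poincare distance through base point 0, the only case
  that chains starting at 0 require. Write \<open>b\<close> as the Moebius image of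
  \<open>m\<close>, then combine the preceding inequality with the addition theorem for
  \<open>artanh\<close>.\<close>

lemma artanh_norm_triangle:
  assumes "cmod a < 1" "cmod b < 1"
  shows "artanh (cmod b) \<le> artanh (cmod a) + poincare_dist a b"
proof -
  define m where "m = Moebius_function 0 a b"
  have m: "cmod m < 1" unfolding m_def by (rule Moebius_function_norm_lt_1[OF assms])
  have "b = Moebius_function 0 (-a) m"
    unfolding m_def by (rule Moebius_function_compose[symmetric]) (use assms in auto)
  then have b: "b = (a + m) / (1 + cnj a * m)"
    by (simp add: Moebius_function_simple add.commute)
  have p: "1 + cmod a * cmod m > 0" by (simp add: add_pos_nonneg)
  have nz: "cmod (1 + cnj a * m) > 0"
  proof -
    have "cmod (cnj a * m) < 1" using norm_mult_less[of "cnj a" 1 m 1] assms(1) m by simp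
    then have "1 + cnj a * m \<noteq> 0"
      by (metis add_eq_0_iff norm_minus_cancel norm_one order_less_irrefl)
    then show ?thesis by simp
  qed
  have le: "cmod b \<le> (cmod a + cmod m) / (1 + cmod a * cmod m)"
    unfolding b norm_divide using norm_add_le_pseudohyperbolic[OF assms(1) m] p nz
    by (simp add: divide_le_eq le_divide_eq)
  have "(cmod a + cmod m) / (1 + cmod a * cmod m) < 1"
  proof -
    have "0 < (1 - cmod a) * (1 - cmod m)" using assms(1) m by simp
    then have "cmod a + cmod m < 1 + cmod a * cmod m" by (simp add: algebra_simps)
    then show ?thesis using p by simp
  qed
  from artanh_mono[OF _ le this]
  have "artanh (cmod b) \<le> artanh ((cmod a + cmod m) / (1 + cmod a * cmod m))"
    by (smt (verit) norm_ge_zero)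
  also have "\<dots> = artanh (cmod a) + artanh (cmod m)" using assms(1) m by (intro artanh_add) auto
  finally show ?thesis by (simp add: poincare_dist_Moebius m_def)
qed

text \<open>Moebius maps on both sides move \<open>a\<close> and \<open>h a\<close> to 0, where the
  Schwarz lemma applies.\<close>

lemma Schwarz_Pick:
  assumes h: "h holomorphic_on ball 0 1" "h ` ball 0 1 \<subseteq> ball 0 1"
    and ab: "cmod a < 1" "cmod b < 1"
  shows "poincare_dist (h a) (h b) \<le> poincare_dist a b"
proof -
  have h1: "cmod (h z) < 1" if "cmod z < 1" for z using h(2) that by fastforce
  define k where "k = (\<lambda>z. Moebius_function 0 (h a) (h (Moebius_function 0 (-a) z)))"
  have inv: "Moebius_function 0 (-a) (Moebius_function 0 a b) = b"
    using ab by (intro Moebius_function_compose) auto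
  have Mb: "cmod (Moebius_function 0 a b) < 1" by (rule Moebius_function_norm_lt_1[OF ab])
  have Ma: "cmod (Moebius_function 0 (-a) z) < 1" if "cmod z < 1" for z
    using that ab(1) by (intro Moebius_function_norm_lt_1) auto
  have "cmod (k (Moebius_function 0 a b)) \<le> cmod (Moebius_function 0 a b)"
  proof (rule Schwarz_Lemma(1))
    have "Moebius_function 0 (-a) holomorphic_on ball 0 1"
      using ab(1) by (intro Moebius_function_holomorphic) simp
    then have "(h \<circ> Moebius_function 0 (-a)) holomorphic_on ball 0 1"
      by (rule holomorphic_on_compose_gen[OF _ h(1)]) (use Ma in auto)
    then have "(Moebius_function 0 (h a) \<circ> (h \<circ> Moebius_function 0 (-a))) holomorphic_on ball 0 1"
      by (rule holomorphic_on_compose_gen[OF _ Moebius_function_holomorphic[OF h1[OF ab(1)]]])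
         (use Ma h1 in auto)
    then show "k holomorphic_on ball 0 1" by (simp add: k_def o_def)
    show "k 0 = 0" by (simp add: k_def Moebius_function_of_zero Moebius_function_eq_zero)
    show "cmod (k z) < 1" if "cmod z < 1" for z
      unfolding k_def by (intro Moebius_function_norm_lt_1 h1 Ma ab that)
  qed (rule Mb)
  then show ?thesis
    using Mb unfolding poincare_dist_Moebius k_def inv
    by (intro artanh_mono) (auto intro: less_le_trans[of _ 0])
qed

section \<open>Estimates for the Kobayashi distance\<close>

lemma disc_chain_functional_bound:
  assumes ch: "disc_chain D 0 w N f a b" and c: "\<And>z. z \<in> D \<Longrightarrow> cmod (cpair c z) < 1"
  shows "artanh (cmod (cpair c w)) \<le> (\<Sum>j=1..N. poincare_dist (a j) (b j))"
proof -
  have N: "N \<ge> 1" and f1: "f 1 (a 1) = 0" and fN: "f N (b N) = w"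
    and step: "\<And>j. j \<in> {1..<N} \<Longrightarrow> f j (b j) = f (Suc j) (a (Suc j))"
    and disc: "\<And>j. j \<in> {1..N} \<Longrightarrow> analytic_disc D (f j) \<and> cmod (a j) < 1 \<and> cmod (b j) < 1"
    using ch unfolding disc_chain_def mem_ball_0 by blast+
  have in1: "cmod (cpair c (f j t)) < 1" if "j \<in> {1..N}" "cmod t < 1" for j t
    using disc[OF that(1)] that(2) c by (auto simp: analytic_disc_def image_subset_iff)
  \<comment> \<open>One link of the chain: a functional bounded by 1 on \<open>D\<close> maps each
    disc into the unit disc, so Schwarz-Pick and the triangle inequality through 0 apply. Induction
    along the chain adds the links up.\<close>
  have pick: "artanh (cmod (cpair c (f j (b j)))) \<le>
      artanh (cmod (cpair c (f j (a j)))) + poincare_dist (a j) (b j)" if j: "j \<in> {1..N}" for j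
  proof -
    have hol: "(\<lambda>t. cpair c (f j t)) holomorphic_on ball 0 1"
      using disc[OF j] unfolding cpair_def analytic_disc_def by (intro holomorphic_intros) auto
    have im: "(\<lambda>t. cpair c (f j t)) ` ball 0 1 \<subseteq> ball 0 1"
      using in1[OF j] by (simp add: image_subset_iff)
    have "poincare_dist (cpair c (f j (a j))) (cpair c (f j (b j))) \<le> poincare_dist (a j) (b j)"
      using Schwarz_Pick[OF hol im] disc[OF j] by blast
    moreover have "artanh (cmod (cpair c (f j (b j)))) \<le>
      artanh (cmod (cpair c (f j (a j)))) + poincare_dist (cpair c (f j (a j))) (cpair c (f j (b j)))"
      using disc[OF j] by (intro artanh_norm_triangle in1[OF j]) blast+
    ultimately show ?thesis by linarith
  qed
  have "k \<ge> 1 \<Longrightarrow> k \<le> N \<Longrightarrow>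
      artanh (cmod (cpair c (f k (b k)))) \<le> (\<Sum>j=1..k. poincare_dist (a j) (b j))" for k
  proof (induction k rule: nat_induct_at_least)
    case base
    then show ?case using pick[of 1] f1 by simp
  next
    case (Suc k)
    then show ?case using pick[of "Suc k"] step[of k] by simp
  qed
  from this[of N] N fN show ?thesis by simp
qed

lemma disc_chain_sum_nonneg:
  "disc_chain D z w N f a b \<Longrightarrow> 0 \<le> (\<Sum>j=1..N. poincare_dist (a j) (b j))"
  by (intro sum_nonneg poincare_dist_nonneg) (auto simp: disc_chain_def)

lemma kobayashi_le:
  assumes "disc_chain D z w N f a b"
  shows "kobayashi D z w \<le> (\<Sum>j=1..N. poincare_dist (a j) (b j))"
  unfolding kobayashi_def
  using assms disc_chain_sum_nonneg by (intro cInf_lower bdd_belowI[of _ 0]) blast+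

text \<open>The given chain makes the set under the infimum nonempty; the real \<open>Inf\<close> of
  an empty set would carry no information.\<close>

lemma kobayashi_lessD:
  assumes "kobayashi D z w < r" "disc_chain D z w N0 f0 a0 b0"
  obtains N f a b where "disc_chain D z w N f a b" "(\<Sum>j=1..N. poincare_dist (a j) (b j)) < r"
  using assms unfolding kobayashi_def by (blast dest: cInf_lessD[rotated])

lemma analytic_disc_line:
  assumes "balanced D" "z \<in> D" shows "analytic_disc D (\<lambda>t. t *s z)"
  using assms by (auto simp: analytic_disc_def balanced_def intro!: holomorphic_intros)

lemma kobayashi_zero_scale_le:
  assumes "balanced D" "z \<in> D" "0 \<le> t" "t < 1"
  shows "kobayashi D 0 (of_real t *s z) \<le> artanh t"
proof -
  have "disc_chain D 0 (of_real t *s z) 1 (\<lambda>_ t. t *s z) (\<lambda>_. 0) (\<lambda>_. of_real t)"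
    using assms by (simp add: disc_chain_def analytic_disc_line)
  from kobayashi_le[OF this] show ?thesis using assms by (simp add: poincare_dist_0)
qed

lemma disc_chain_exists:
  assumes D: "open D" "balanced D" and xy: "x \<in> D" "y \<in> D"
  shows "\<exists>N f a b. disc_chain D x y N f a b"
proof -
  obtain r where r: "r > 1" "of_real r *s x \<in> D" using open_scale_up[OF D(1) xy(1)] by blast
  obtain q where q: "q > 1" "of_real q *s y \<in> D" using open_scale_up[OF D(1) xy(2)] by blast
  have 2: "{1..2} = {1, 2::nat}" "{1..<2} = {1::nat}" by auto
  \<comment> \<open>Two linear discs meeting at 0. The dilations \<open>r\<close> and
    \<open>q\<close> above 1 place \<open>x\<close> and \<open>y\<close> at the interior parameters
    \<open>1 / r\<close> and \<open>1 / q\<close>.\<close>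
  have "disc_chain D x y 2 (\<lambda>j t. t *s (if j = 1 then of_real r *s x else of_real q *s y))
     (\<lambda>j. if j = 1 then of_real (1 / r) else 0) (\<lambda>j. if j = 1 then 0 else of_real (1 / q))"
    using r q analytic_disc_line[OF D(2)]
    by (auto simp: disc_chain_def 2 vector_smult_assoc norm_divide)
  then show ?thesis by blast
qed

text \<open>Composing every disc of a chain with \<open>g\<close> yields a chain in
  \<open>D'\<close> with the same parameters and hence the same length.\<close>

lemma kobayashi_holomorphic_decreasing:
  assumes g: "cholomorphic_on g D" "g ` D \<subseteq> D'" and ch: "disc_chain D x y N0 f0 a0 b0"
    and less: "kobayashi D x y < r"
  shows "kobayashi D' (g x) (g y) < r"
proof -
  obtain N f a b where c: "disc_chain D x y N f a b" "(\<Sum>j=1..N. poincare_dist (a j) (b j)) < r"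
    using kobayashi_lessD[OF less ch] .
  have an: "analytic_disc D' (\<lambda>t. g (h t))" if h: "analytic_disc D h" for h
  proof -
    have "(\<lambda>t. g (h t) $ i) holomorphic_on ball 0 1" for i
    proof (rule holomorphic_onI, rule field_differentiable_at_within)
      fix t :: complex assume t: "t \<in> ball 0 1"
      then obtain v where "(h has_derivative (\<lambda>s. s *s v)) (at t)"
        using holomorphic_curve_has_derivative[of h "ball 0 1" t] h by (auto simp: analytic_disc_def)
      moreover have "h t \<in> D" using h t by (auto simp: analytic_disc_def)
      ultimately obtain v' where "((\<lambda>t. g (h t)) has_derivative (\<lambda>s. s *s v')) (at t)"
        using cholomorphic_curve[OF g(1)] by blast
      from curve_component_field_derivative[OF this]
      show "(\<lambda>t. g (h t) $ i) field_differentiable at t" unfolding field_differentiable_def by blast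
    qed
    moreover have "(\<lambda>t. g (h t)) ` ball 0 1 \<subseteq> D'"
      using h g(2) unfolding analytic_disc_def by blast
    ultimately show ?thesis by (simp add: analytic_disc_def)
  qed
  have "disc_chain D' (g x) (g y) N (\<lambda>j t. g (f j t)) a b"
    using c(1) an by (auto simp: disc_chain_def)
  from kobayashi_le[OF this] c(2) show ?thesis by linarith
qed

section \<open>Invariance of the two invariants under automorphisms\<close>

definition fridman_radii :: "(complex ^ 'n) set \<Rightarrow> complex ^ 'n \<Rightarrow> real set" where
  "fridman_radii D z =
     {tanh r | r. r > 0 \<and> (\<exists>f\<in>inj_hol (ball 0 1) D. f 0 = z \<and> kobayashi_ball D z r \<subseteq> f ` ball 0 1)}"

definition squeezing_radii :: "(complex ^ 'n) set \<Rightarrow> complex ^ 'n \<Rightarrow> real set" where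
  "squeezing_radii D z = {r. r > 0 \<and> (\<exists>f\<in>inj_hol D (ball 0 1). f z = 0 \<and> ball 0 r \<subseteq> f ` D)}"

lemma inj_hol_compose:
  "f \<in> inj_hol A B \<Longrightarrow> g \<in> inj_hol B C \<Longrightarrow> g \<circ> f \<in> inj_hol A C"
  unfolding inj_hol_def
  by (auto intro: cholomorphic_on_compose comp_inj_on inj_on_subset simp: image_subset_iff)

lemma automorphism_inj_hol: "automorphism D \<psi> \<Longrightarrow> \<psi> \<in> inj_hol D D"
  by (auto simp: automorphism_def inj_hol_def bij_betw_def)

lemma squeezing_radii_automorphism:
  assumes "automorphism D \<psi>" "p \<in> D"
  shows "squeezing_radii D (\<psi> p) \<subseteq> squeezing_radii D p"
proof
  fix r assume "r \<in> squeezing_radii D (\<psi> p)"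
  then obtain f where f: "r > 0" "f \<in> inj_hol D (ball 0 1)" "f (\<psi> p) = 0" "ball 0 r \<subseteq> f ` D"
    by (auto simp: squeezing_radii_def)
  have "(f \<circ> \<psi>) ` D = f ` D"
    using assms(1) by (simp add: automorphism_def bij_betw_def flip: image_image o_def image_comp)
  then show "r \<in> squeezing_radii D p"
    using f inj_hol_compose[OF automorphism_inj_hol[OF assms(1)] f(2)]
    by (auto simp: squeezing_radii_def intro!: bexI[of _ "f \<circ> \<psi>"])
qed

text \<open>The inverse automorphism does not increase Kobayashi distances, so it carries the ball
  about \<open>\<psi> p\<close> into the ball about \<open>p\<close>, which \<open>f\<close> covers;
  hence \<open>\<psi> \<circ> f\<close> covers the former.\<close>

lemma fridman_radii_automorphism:
  assumes D: "open D" "balanced D" and \<psi>: "automorphism D \<psi>" and p: "p \<in> D"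
  shows "fridman_radii D p \<subseteq> fridman_radii D (\<psi> p)"
proof
  fix t assume "t \<in> fridman_radii D p"
  then obtain r f where f: "t = tanh r" "r > 0" "f \<in> inj_hol (ball 0 1) D" "f 0 = p"
      "kobayashi_ball D p r \<subseteq> f ` ball 0 1"
    by (auto simp: fridman_radii_def)
  have bij: "bij_betw \<psi> D D" and hol: "cholomorphic_on (inv_into D \<psi>) D"
    using \<psi> by (auto simp: automorphism_def)
  have "kobayashi_ball D (\<psi> p) r \<subseteq> (\<psi> \<circ> f) ` ball 0 1"
  proof
    fix w assume "w \<in> kobayashi_ball D (\<psi> p) r"
    then have w: "w \<in> D" "kobayashi D (\<psi> p) w < r" by (auto simp: kobayashi_ball_def)
    have \<psi>p: "\<psi> p \<in> D" using bij p by (auto simp: bij_betw_def)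
    obtain N h a b where ch: "disc_chain D (\<psi> p) w N h a b"
      using disc_chain_exists[OF D \<psi>p w(1)] by blast
    have im: "inv_into D \<psi> ` D \<subseteq> D" using bij_betw_inv_into[OF bij] by (auto simp: bij_betw_def)
    have "kobayashi D (inv_into D \<psi> (\<psi> p)) (inv_into D \<psi> w) < r"
      by (rule kobayashi_holomorphic_decreasing[OF hol im ch w(2)])
    moreover have "inv_into D \<psi> (\<psi> p) = p" using bij p by (simp add: bij_betw_inv_into_left)
    moreover have "inv_into D \<psi> w \<in> D" using im w(1) by blast
    ultimately have "inv_into D \<psi> w \<in> f ` ball 0 1" using f(5) by (auto simp: kobayashi_ball_def)
    moreover have "\<psi> (inv_into D \<psi> w) = w" using bij w(1) by (simp add: bij_betw_inv_into_right)
    ultimately show "w \<in> (\<psi> \<circ> f) ` ball 0 1" by force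
  qed
  then show "t \<in> fridman_radii D (\<psi> p)"
    using f inj_hol_compose[OF f(3) automorphism_inj_hol[OF \<psi>]]
    by (auto simp: fridman_radii_def intro!: exI[of _ r] bexI[of _ "\<psi> \<circ> f"])
qed

section \<open>Comparison of the two invariants at the origin\<close>

lemma balanced_unit_ball: "balanced (ball (0 :: complex ^ 'n) 1)"
  unfolding balanced_def
  by (auto simp: norm_smult) (metis le_less_trans mult_left_le_one_le norm_ge_zero)

lemma clinear_inj_hol:
  assumes M: "Vector_Spaces.linear (*s) (*s) M" "inj M" and t: "t \<noteq> 0"
    and "\<And>z. z \<in> A \<Longrightarrow> M (t *\<^sub>R z) \<in> B"
  shows "(\<lambda>z. M (t *\<^sub>R z)) \<in> inj_hol A B"
proof -
  have s: "Vector_Spaces.linear (*s) (*s) (\<lambda>z :: complex ^ 'n. t *\<^sub>R z)"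
    by unfold_locales (auto simp: scaleR_vec_eq_smult vector_smult_assoc vector_add_ldistrib mult.commute)
  have "cholomorphic_on (\<lambda>z. M (t *\<^sub>R z)) A"
    using cholomorphic_on_clinear[OF Vector_Spaces.linear_compose[OF s M(1)]] by (simp add: o_def)
  moreover have "inj_on (\<lambda>z. M (t *\<^sub>R z)) A"
  proof (rule inj_onI)
    fix x y assume "M (t *\<^sub>R x) = M (t *\<^sub>R y)"
    then have "t *\<^sub>R x = t *\<^sub>R y" by (rule injD[OF M(2)])
    then show "x = y" using t by simp
  qed
  ultimately show ?thesis using assms(4) by (auto simp: inj_hol_def)
qed

text \<open>Linearise the squeezing map to \<open>L\<close>, with inverse \<open>M\<close>. The map
  \<open>M (r *\<^sub>R z)\<close> sends the unit ball into \<open>D\<close>, and the functional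
  bound on chains shows that its image contains the Kobayashi ball of radius
  \<open>artanh r\<close>, which makes sense because \<open>r < 1\<close>.\<close>

lemma squeezing_radii_imp_fridman_radii:
  fixes D :: "(complex ^ 'n) set"
  assumes D: "open D" "bounded D" "balanced D" "convex D" "D \<noteq> {}"
    and r: "r \<in> squeezing_radii D 0" "r < 1"
  shows "r \<in> fridman_radii D 0"
proof -
  obtain f where f: "r > 0" "f \<in> inj_hol D (ball 0 1)" "f 0 = 0" "ball 0 r \<subseteq> f ` D"
    using r(1) by (auto simp: squeezing_radii_def)
  have "(*\<^sub>R) r ` ball 0 1 \<subseteq> f ` D" using f(4,1) by (auto simp: image_subset_iff subset_iff)
  from linear_sandwich[OF f(2,3) D(1,3,4,2,5) open_ball balanced_unit_ball convex_ball f(1) this]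
  obtain L M :: "complex ^ 'n \<Rightarrow> complex ^ 'n" where L: "Vector_Spaces.linear (*s) (*s) L" "Vector_Spaces.linear (*s) (*s) M"
    "\<forall>x. L (M x) = x" "\<forall>x. M (L x) = x" "L ` D \<subseteq> ball 0 1" "(*\<^sub>R) r ` ball 0 1 \<subseteq> L ` D"
    by blast
  interpret lin: Vector_Spaces.linear "(*s)" "(*s)" L by (rule L(1))
  interpret linM: Vector_Spaces.linear "(*s)" "(*s)" M by (rule L(2))
  have bl: "linear L" by (rule bounded_linear.linear[OF bounded_linear_clinear[OF L(1)]])
  have inj: "inj M" using L(3) by (metis injI)
  have MD: "M (r *\<^sub>R z) \<in> D" if "z \<in> ball 0 1" for z
  proof -
    have "r *\<^sub>R z \<in> L ` D" using L(6) that by blast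
    then show ?thesis using L(4) by auto
  qed
  let ?F = "\<lambda>z. M (r *\<^sub>R z)"
  have F: "?F \<in> inj_hol (ball 0 1) D"
    by (rule clinear_inj_hol[OF L(2) inj _ MD]) (use f(1) in auto)
  \<comment> \<open>The image to be reached is \<open>r\<close> times this set. It contains
    \<open>D\<close>, so functionals bounded by 1 on it are also bounded by 1 along chains in
    \<open>D\<close>.\<close>
  define G where "G = L -` ball 0 1"
  have G: "open G" "balanced G" "convex G" "G \<noteq> {}" "D \<subseteq> G"
  proof -
    show "open G" unfolding G_def
      by (intro open_vimage open_ball linear_continuous_on bounded_linear_clinear L(1))
    show "balanced G" using balanced_unit_ball by (auto simp: balanced_def G_def lin.scale)
    show "convex G" unfolding G_def by (intro convex_linear_vimage bl convex_ball)
    show "D \<subseteq> G" using L(5) by (auto simp: G_def)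
    then show "G \<noteq> {}" using D(5) by blast
  qed
  have "kobayashi_ball D 0 (artanh r) \<subseteq> ?F ` ball 0 1"
  proof
    fix w assume "w \<in> kobayashi_ball D 0 (artanh r)"
    then have w: "w \<in> D" "kobayashi D 0 w < artanh r" by (auto simp: kobayashi_ball_def)
    have "(1 / r) *\<^sub>R w \<in> G"
    proof (rule ccontr)
      assume "(1 / r) *\<^sub>R w \<notin> G"
      from balanced_convex_separation[OF G(1-4) this] obtain a where
        a: "\<And>z. z \<in> G \<Longrightarrow> cmod (cpair a z) < 1" "1 \<le> cmod (cpair a ((1 / r) *\<^sub>R w))" by blast
      have a': "\<And>z. z \<in> D \<Longrightarrow> cmod (cpair a z) < 1" using a(1) G(5) by blast
      have "r \<le> cmod (cpair a w)"
        using a(2) f(1) by (simp add: scaleR_vec_eq_smult norm_mult norm_divide field_simps)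
      then have "artanh r \<le> artanh (cmod (cpair a w))" using f(1) a'[OF w(1)] by (intro artanh_mono) auto
      moreover obtain N0 f0 a0 b0 where "disc_chain D 0 w N0 f0 a0 b0"
        using disc_chain_exists[OF D(1,3) balanced_zero[OF D(3,5)] w(1)] by blast
      from kobayashi_lessD[OF w(2) this] obtain N h p q where
        "disc_chain D 0 w N h p q" "(\<Sum>j=1..N. poincare_dist (p j) (q j)) < artanh r" by blast
      moreover from disc_chain_functional_bound[OF this(1) a']
      have "artanh (cmod (cpair a w)) \<le> (\<Sum>j=1..N. poincare_dist (p j) (q j))" .
      ultimately show False by linarith
    qed
    then have "L ((1 / r) *\<^sub>R w) \<in> ball 0 1" by (simp add: G_def)
    moreover have "?F (L ((1 / r) *\<^sub>R w)) = w"
      using f(1) L(4) by (simp add: linear_cmul[OF bl])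
    ultimately show "w \<in> ?F ` ball 0 1" by (metis image_eqI)
  qed
  moreover have "artanh r > 0" using artanh_strict_mono[of 0 r] f(1) r(2) by simp
  moreover have "tanh (artanh r) = r" using f(1) r(2) by (intro tanh_artanh) auto
  moreover have "?F 0 = 0" by (simp add: linM.zero)
  ultimately show ?thesis using F unfolding fridman_radii_def
    by (intro CollectI exI[of _ "artanh r"] conjI bexI[of _ ?F]) auto
qed

text \<open>Linear discs show that the Kobayashi ball of radius \<open>artanh t\<close> contains
  \<open>t\<close> times \<open>D\<close>, so the embedded unit ball covers that set. Linearising
  gives an \<open>M\<close> for which \<open>M (t *\<^sub>R z)\<close> maps \<open>D\<close> into
  the unit ball and onto a set containing the ball of radius \<open>t\<close>.\<close>

lemma fridman_radii_imp_squeezing_radii: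
  fixes D :: "(complex ^ 'n) set"
  assumes D: "open D" "balanced D" "convex D" "D \<noteq> {}" and t: "t \<in> fridman_radii D 0"
  shows "t \<in> squeezing_radii D 0"
proof -
  obtain r f where f: "t = tanh r" "r > 0" "f \<in> inj_hol (ball 0 1) D" "f 0 = 0"
      "kobayashi_ball D 0 r \<subseteq> f ` ball 0 1"
    using t by (auto simp: fridman_radii_def)
  have t01: "0 < t" "t < 1" using f(1,2) by (auto simp: tanh_real_lt_1)
  have art: "artanh t = r" using f(1) by (simp add: artanh_tanh_real)
  have sub: "(*\<^sub>R) t ` D \<subseteq> f ` ball 0 1"
  proof (rule order_trans[OF _ f(5)], rule image_subsetI)
    fix z assume z: "z \<in> D"
    \<comment> \<open>The Kobayashi ball is defined by a strict inequality; \<open>q > 1\<close>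
      replaces \<open>t\<close> by the smaller \<open>t / q\<close>.\<close>
    obtain q where q: "q > 1" "of_real q *s z \<in> D" using open_scale_up[OF D(1) z] by blast
    have eq: "of_real (t / q) *s (of_real q *s z) = t *\<^sub>R z"
      using q(1) by (simp add: vector_smult_assoc scaleR_vec_eq_smult)
    have "t / q < t" using q(1) t01 by (simp add: field_simps)
    moreover have "0 < t / q" using q(1) t01 by simp
    ultimately have "kobayashi D 0 (t *\<^sub>R z) \<le> artanh (t / q)" "artanh (t / q) < artanh t"
      using kobayashi_zero_scale_le[OF D(2) q(2), of "t / q"] t01 artanh_strict_mono[of "t / q" t]
      unfolding eq by auto
    moreover have "t *\<^sub>R z \<in> D" using D(2) z t01 by (auto simp: balanced_def scaleR_vec_eq_smult)
    ultimately show "t *\<^sub>R z \<in> kobayashi_ball D 0 r" using art by (simp add: kobayashi_ball_def)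
  qed
  have ne: "ball (0 :: complex ^ 'n) 1 \<noteq> {}" by simp
  from linear_sandwich[OF f(3,4) open_ball balanced_unit_ball convex_ball bounded_ball ne D(1-3) t01(1) sub]
  obtain L M :: "complex ^ 'n \<Rightarrow> complex ^ 'n" where L: "Vector_Spaces.linear (*s) (*s) L" "Vector_Spaces.linear (*s) (*s) M"
    "\<forall>x. L (M x) = x" "\<forall>x. M (L x) = x" "L ` ball 0 1 \<subseteq> D" "(*\<^sub>R) t ` D \<subseteq> L ` ball 0 1"
    by blast
  interpret linM: Vector_Spaces.linear "(*s)" "(*s)" M by (rule L(2))
  have bl: "linear L" by (rule bounded_linear.linear[OF bounded_linear_clinear[OF L(1)]])
  have inj: "inj M" using L(3) by (metis injI)
  have MB: "M (t *\<^sub>R z) \<in> ball 0 1" if "z \<in> D" for z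
  proof -
    have "t *\<^sub>R z \<in> L ` ball 0 1" using L(6) that by blast
    then show ?thesis using L(4) by auto
  qed
  let ?F = "\<lambda>z. M (t *\<^sub>R z)"
  have F: "?F \<in> inj_hol D (ball 0 1)"
    by (rule clinear_inj_hol[OF L(2) inj _ MB]) (use t01 in auto)
  have "ball 0 t \<subseteq> ?F ` D"
  proof
    fix y :: "complex ^ 'n" assume "y \<in> ball 0 t"
    then have "(1 / t) *\<^sub>R y \<in> ball 0 1" using t01 by simp
    then have "L ((1 / t) *\<^sub>R y) \<in> D" using L(5) by blast
    moreover have "?F (L ((1 / t) *\<^sub>R y)) = y" using t01 L(4) by (simp add: linear_cmul[OF bl])
    ultimately show "y \<in> ?F ` D" by (metis image_eqI)
  qed
  moreover have "?F 0 = 0" by (simp add: linM.zero)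
  ultimately show ?thesis using F t01 unfolding squeezing_radii_def
    by (intro CollectI conjI bexI[of _ ?F]) auto
qed

lemma squeezing_radii_le_1:
  fixes D :: "(complex ^ 'n) set"
  assumes "r \<in> squeezing_radii D z" shows "r \<le> 1"
proof (rule ccontr)
  assume "\<not> r \<le> 1"
  obtain v :: "complex ^ 'n" where "norm v = 1" using vector_choose_size[of 1] by auto
  then have "v \<in> ball 0 r" using \<open>\<not> r \<le> 1\<close> by simp
  then have "v \<in> ball 0 1" using assms by (force simp: squeezing_radii_def inj_hol_def)
  then show False using \<open>norm v = 1\<close> by simp
qed

lemma squeezing_radii_nonempty:
  fixes D :: "(complex ^ 'n) set"
  assumes D: "open D" "bounded D" "0 \<in> D"
  shows "squeezing_radii D 0 \<noteq> {}"
proof -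
  obtain R where R: "R > 0" "\<And>z. z \<in> D \<Longrightarrow> norm z < R"
    using D(2) unfolding bounded_pos_less by blast
  obtain e where e: "e > 0" "ball 0 e \<subseteq> D" using D open_contains_ball by blast
  have id: "Vector_Spaces.linear (*s) (*s) (\<lambda>z :: complex ^ 'n. z)"
    by unfold_locales (auto simp: algebra_simps)
  have F: "(\<lambda>z. inverse R *\<^sub>R z) \<in> inj_hol D (ball 0 1)"
    using clinear_inj_hol[OF id, of "inverse R" D "ball 0 1"] R by (auto simp: field_simps)
  have "ball 0 (e / R) \<subseteq> (\<lambda>z. inverse R *\<^sub>R z) ` D"
  proof
    fix y :: "complex ^ 'n" assume "y \<in> ball 0 (e / R)"
    then have "R *\<^sub>R y \<in> D" using e R by (auto simp: field_simps)
    then show "y \<in> (\<lambda>z. inverse R *\<^sub>R z) ` D" using R(1) by (intro image_eqI[of _ _ "R *\<^sub>R y"]) auto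
  qed
  then have "e / R \<in> squeezing_radii D 0"
    using F e R by (auto simp: squeezing_radii_def intro!: bexI[of _ "\<lambda>z. inverse R *\<^sub>R z"])
  then show ?thesis by blast
qed

text \<open>The sets themselves can differ: 1 may be a squeezing radius, whereas
  \<open>tanh r\<close> is always below 1. Every smaller positive number than a squeezing radius is
  a Fridman radius, so the suprema agree by density.\<close>

lemma Sup_squeezing_radii_eq:
  fixes D :: "(complex ^ 'n) set"
  assumes D: "open D" "bounded D" "balanced D" "convex D" "D \<noteq> {}"
  shows "Sup (squeezing_radii D 0) = Sup (fridman_radii D 0)" "0 < Sup (squeezing_radii D 0)"
proof -
  let ?S = "squeezing_radii D 0" and ?E = "fridman_radii D 0"
  have 0: "0 \<in> D" by (rule balanced_zero[OF D(3,5)])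
  obtain s where s: "s \<in> ?S" using squeezing_radii_nonempty[OF D(1,2) 0] by blast
  have pos: "x > 0" if "x \<in> ?S" for x using that by (simp add: squeezing_radii_def)
  have down: "y \<in> ?S" if "x \<in> ?S" "0 < y" "y < x" for x y
    using that subset_ball[of y x 0] by (auto simp: squeezing_radii_def)
  have ES: "?E \<subseteq> ?S" using fridman_radii_imp_squeezing_radii[OF D(1,3-5)] by blast
  have SE: "y \<in> ?E" if "x \<in> ?S" "0 < y" "y < x" for x y
    using squeezing_radii_imp_fridman_radii[OF D down[OF that]] squeezing_radii_le_1[OF that(1)] that
    by simp
  have bS: "bdd_above ?S" using squeezing_radii_le_1 by (intro bdd_aboveI[of _ 1])
  then have bE: "bdd_above ?E" by (rule bdd_above_mono[OF _ ES])
  have E0: "s / 2 \<in> ?E" using SE[OF s, of "s / 2"] pos[OF s] by simp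
  show "0 < Sup ?S" using pos[OF s] cSup_upper[OF s bS] by linarith
  show "Sup ?S = Sup ?E"
  proof (rule antisym)
    show "Sup ?E \<le> Sup ?S" using E0 by (intro cSup_subset_mono bS ES) auto
    show "Sup ?S \<le> Sup ?E"
    proof (rule cSup_least)
      show "?S \<noteq> {}" using s by blast
      fix x assume x: "x \<in> ?S"
      show "x \<le> Sup ?E"
      proof (rule dense_le_bounded[OF pos[OF x]])
        fix y assume "0 < y" "y < x"
        from cSup_upper[OF SE[OF x this] bE] show "y \<le> Sup ?E" .
      qed
    qed
  qed
qed

theorem corollary4:
  fixes D :: "(complex ^ 'n) set"
  assumes "cdomain D" and "bounded D" and "balanced D" and "convex D" and "homogeneous D"
  shows "\<forall>z\<in>D. quotient_inv D z = 1"
proof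
  fix z assume z: "z \<in> D"
  have D: "open D" "D \<noteq> {}" using assms(1) by (auto simp: cdomain_def)
  have 0: "0 \<in> D" by (rule balanced_zero[OF assms(3) D(2)])
  obtain \<phi> where \<phi>: "automorphism D \<phi>" "\<phi> z = 0" using assms(5) z 0 unfolding homogeneous_def by blast
  obtain \<psi> where \<psi>: "automorphism D \<psi>" "\<psi> 0 = z" using assms(5) z 0 unfolding homogeneous_def by blast
  \<comment> \<open>Each automorphism gives one inclusion; one moving \<open>z\<close> to 0 and one
    moving 0 to \<open>z\<close> together give equality.\<close>
  have "squeezing_radii D z = squeezing_radii D 0"
    using squeezing_radii_automorphism[OF \<phi>(1) z] squeezing_radii_automorphism[OF \<psi>(1) 0] \<phi>(2) \<psi>(2)
    by auto
  moreover have "fridman_radii D z = fridman_radii D 0"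
    using fridman_radii_automorphism[OF D(1) assms(3) \<phi>(1) z]
      fridman_radii_automorphism[OF D(1) assms(3) \<psi>(1) 0] \<phi>(2) \<psi>(2) by auto
  ultimately have "quotient_inv D z = Sup (squeezing_radii D 0) / Sup (fridman_radii D 0)"
    by (simp add: quotient_inv_def squeezing_def fridman_def flip: squeezing_radii_def fridman_radii_def)
  then show "quotient_inv D z = 1"
    using Sup_squeezing_radii_eq[OF D(1) assms(2-4) D(2)] by simp
qed

end
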